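(* Let $C^{(1)}_{-1}:=\{f\in L^1(\mu): f\ge -1\}$. Then $$\{A\in\mathrm{Aff}_{\mathbb{R}}(L^1(\mu)):\ AC^{(1)}_{-1}=C^{(1)}_{-1}\}=\{(S'-1,\,U^{(1)}_S):\ S\in\mathrm{Aut}_1(X,\mathcal{A},\mu)\}.$$
   Context: $(X,\mathcal{A},\mu)$ is a standard $\sigma$-finite non-atomic measure space. For an invertible nonsingular transformation $S$ of $X$, $S':=\frac{d\mu\circ S^{-1}}{d\mu}$ and $U^{(1)}_Sf:=f\circ S^{-1}\cdot S'$ (an invertible isometry of $L^1(\mu)$). $\mathrm{Aut}_1(X,\mathcal{A},\mu)$ is the group of invertible nonsingular $S$ with $S'-1\in L^1(\mu)$. $\mathcal{U}_{\mathbb{R}}(L^1(\mu))$ is the group of invertible isometries of $L^1(\mu)$ preserving the real subspace $L^1_{\mathbb{R}}(\mu)$; $\mathrm{Aff}_{\mathbb{R}}(L^1(\mu)):=L^1_{\mathbb{R}}(\mu)\rtimes\mathcal{U}_{\mathbb{R}}(L^1(\mu))$, where $(f,V)$ acts by $h\mapsto f+Vh$. *)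

theory Defs
  imports "HOL-Analysis.Analysis"
begin

definition non_atomic :: "'a measure \<Rightarrow> bool" where
  "non_atomic M \<longleftrightarrow> (\<forall>A\<in>sets M. emeasure M A > 0 \<longrightarrow>
     (\<exists>B\<in>sets M. B \<subseteq> A \<and> 0 < emeasure M B \<and> emeasure M B < emeasure M A))"

definition standard_sf_nonatomic :: "('a::polish_space) measure \<Rightarrow> bool" where
  "standard_sf_nonatomic M \<longleftrightarrow> sets M = sets borel \<and> sigma_finite_measure M \<and> non_atomic M"

text \<open>L^1(mu) is represented by complex-valued integrable functions; elements of
  L^1 are equivalence classes modulo a.e. equality, so all identities below
  are up to a.e. equality.\<close>

definition L1 :: "'a measure \<Rightarrow> ('a \<Rightarrow> complex) set" where
  "L1 M = {h. integrable M h}"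

definition L1R :: "'a measure \<Rightarrow> ('a \<Rightarrow> complex) set" where
  "L1R M = {h. integrable M h \<and> (AE x in M. Im (h x) = 0)}"

definition aeeq :: "'a measure \<Rightarrow> ('a \<Rightarrow> complex) \<Rightarrow> ('a \<Rightarrow> complex) \<Rightarrow> bool" where
  "aeeq M f g \<longleftrightarrow> (AE x in M. f x = g x)"

definition L1norm :: "'a measure \<Rightarrow> ('a \<Rightarrow> complex) \<Rightarrow> real" where
  "L1norm M h = (\<integral>x. cmod (h x) \<partial>M)"

definition Cm1 :: "'a measure \<Rightarrow> ('a \<Rightarrow> complex) set" where
  "Cm1 M = {h. integrable M h \<and> (AE x in M. Im (h x) = 0 \<and> Re (h x) \<ge> -1)}"

definition UR :: "'a measure \<Rightarrow> (('a \<Rightarrow> complex) \<Rightarrow> ('a \<Rightarrow> complex)) set" where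
  "UR M = {V.
     (\<forall>h\<in>L1 M. V h \<in> L1 M \<and> L1norm M (V h) = L1norm M h) \<and>
     (\<forall>h\<in>L1 M. \<forall>g\<in>L1 M. aeeq M h g \<longrightarrow> aeeq M (V h) (V g)) \<and>
     (\<forall>h\<in>L1 M. \<forall>g\<in>L1 M. aeeq M (V (\<lambda>x. h x + g x)) (\<lambda>x. V h x + V g x)) \<and>
     (\<forall>h\<in>L1 M. \<forall>c::complex. aeeq M (V (\<lambda>x. c * h x)) (\<lambda>x. c * V h x)) \<and>
     (\<forall>g\<in>L1 M. \<exists>h\<in>L1 M. aeeq M (V h) g) \<and>
     (\<forall>h\<in>L1R M. V h \<in> L1R M) \<and>
     (\<forall>g\<in>L1R M. \<exists>h\<in>L1R M. aeeq M (V h) g)}"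

definition aff_preserves :: "'a measure \<Rightarrow> ('a \<Rightarrow> complex) \<Rightarrow> (('a \<Rightarrow> complex) \<Rightarrow> ('a \<Rightarrow> complex))
    \<Rightarrow> ('a \<Rightarrow> complex) set \<Rightarrow> bool" where
  "aff_preserves M f V C \<longleftrightarrow>
     (\<forall>h\<in>C. (\<lambda>x. f x + V h x) \<in> C) \<and>
     (\<forall>g\<in>C. \<exists>h\<in>C. aeeq M g (\<lambda>x. f x + V h x))"

definition nonsingular_inv :: "'a measure \<Rightarrow> ('a \<Rightarrow> 'a) \<Rightarrow> bool" where
  "nonsingular_inv M S \<longleftrightarrow> bij_betw S (space M) (space M) \<and>
     S \<in> M \<rightarrow>\<^sub>M M \<and> the_inv_into (space M) S \<in> M \<rightarrow>\<^sub>M M \<and>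
     (\<forall>A\<in>sets M. emeasure M (S -` A \<inter> space M) = 0 \<longleftrightarrow> emeasure M A = 0)"

definition Sder :: "'a measure \<Rightarrow> ('a \<Rightarrow> 'a) \<Rightarrow> 'a \<Rightarrow> real" where
  "Sder M S x = enn2real (RN_deriv M (distr M M S) x)"

definition US :: "'a measure \<Rightarrow> ('a \<Rightarrow> 'a) \<Rightarrow> ('a \<Rightarrow> complex) \<Rightarrow> ('a \<Rightarrow> complex)" where
  "US M S f = (\<lambda>x. f (the_inv_into (space M) S x) * complex_of_real (Sder M S x))"

definition Aut1 :: "'a measure \<Rightarrow> ('a \<Rightarrow> 'a) set" where
  "Aut1 M = {S. nonsingular_inv M S \<and> integrable M (\<lambda>x. Sder M S x - 1)}"

end

theory Submission
  imports Defs "HOL-Probability.Distribution_Functions"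
begin

text \<open>An affine map preserving \<open>C\<close> (functions bounded below by \<open>-1\<close>) has a linear part \<open>V\<close> that preserves
  the recession cone of \<open>C\<close> in both directions, so \<open>V\<close> and its inverse are positive isometries.  Such
  operators preserve absolute values, hence they are weighted compositions \<open>h \<mapsto> (h \<circ> T) w\<close>.  The point
  maps belonging to \<open>V\<close> and its inverse are inverse to each other almost everywhere; since the measure
  is non-atomic, each conull Borel set is Borel isomorphic to the whole space by a map equal to the
  identity almost everywhere, so they can be corrected on null sets to a bimeasurable bijection \<open>S\<close>
  with \<open>S\<inverse> = T\<close> and \<open>S' = w\<close> almost everywhere.  Finally \<open>f = S' - 1\<close>: the translation must match the lower
  bound \<open>-1\<close> of \<open>C\<close> with the lower bound \<open>- S'\<close> of \<open>V C\<close>; as \<open>-1\<close> need not be integrable, both bounds are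
  reached through the functions \<open>- 1\<^sub>B\<close> with \<open>B\<close> of finite measure.\<close>

section \<open>Borel embeddings into the real line\<close>

text \<open>Base three with digits 0 and 1 only is free of ambiguity: each tail \<open>g n\<close>
  lies in \<open>[0, 1/2]\<close>, so it is the fractional part of \<open>3 ^ n * y\<close>. It is
  at least \<open>1/3\<close> when its leading digit is 1 and at most \<open>1/6\<close> when that
  digit is 0.\<close>

lemma ternary_digit:
  fixes s :: "nat \<Rightarrow> bool"
  defines "y \<equiv> (\<Sum>m. of_bool (s m) / 3 ^ Suc m :: real)"
  shows "0 \<le> y" "y \<le> 1/2" "1/3 \<le> frac (3 ^ n * y) \<longleftrightarrow> s n"
proof -
  have geo: "(\<lambda>m. 1 / 3 ^ Suc m :: real) sums (1/2)"
    using sums_mult[OF geometric_sums[of "1/3::real"], of "1/3"] by (simp add: power_divide)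
  define g where "g j = (\<Sum>m. of_bool (s (m + j)) / 3 ^ Suc m :: real)" for j
  have sm: "summable (\<lambda>m. of_bool (s (m + j)) / 3 ^ Suc m :: real)" for j
    by (rule summable_comparison_test'[OF sums_summable[OF geo], of 0]) auto
  have g0: "0 \<le> g j" for j unfolding g_def by (rule suminf_nonneg[OF sm]) auto
  have g1: "g j \<le> 1/2" for j
    unfolding g_def sums_unique[OF geo]
    by (rule suminf_le[OF _ sm sums_summable[OF geo]]) (auto simp: divide_simps)
  have gS: "3 * g j = of_bool (s j) + g (Suc j)" for j
  proof -
    have "3 * g j = (\<Sum>m. 3 * (of_bool (s (m + j)) / 3 ^ Suc m))"
      unfolding g_def by (rule suminf_mult[OF sm, symmetric])
    also have "\<dots> = (\<Sum>m. of_bool (s (m + j)) / 3 ^ m)" by simp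
    also have "\<dots> = of_bool (s j) + (\<Sum>m. of_bool (s (Suc m + j)) / 3 ^ Suc m)"
      using suminf_split_head[of "\<lambda>m. of_bool (s (m + j)) / 3 ^ m :: real"]
        summable_mult[OF sm[of j], of 3] by simp
    finally show ?thesis unfolding g_def by simp
  qed
  have y: "y = g 0" by (simp add: y_def g_def)
  show "0 \<le> y" "y \<le> 1/2" using g0 g1 y by auto
  have "frac (3 ^ n * y) = g n"
  proof (induction n)
    case 0
    show ?case using g0[of 0] g1[of 0] y by (simp add: frac_eq)
  next
    case (Suc n)
    have "3 ^ n * y - g n \<in> \<int>" using Suc frac_unique_iff by blast
    then have "3 * (3 ^ n * y - g n) + of_bool (s n) \<in> \<int>" by (intro Ints_add Ints_mult) auto
    moreover have "3 * (3 ^ n * y - g n) + of_bool (s n) = 3 ^ Suc n * y - g (Suc n)"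
      using gS[of n] by (simp add: algebra_simps)
    ultimately have "3 ^ Suc n * y - g (Suc n) \<in> \<int>" by (simp only:)
    then show ?case
      using g0[of "Suc n"] g1[of "Suc n"] unfolding frac_unique_iff by linarith
  qed
  moreover have "1/3 \<le> g n \<longleftrightarrow> s n"
    using gS[of n] g0[of "Suc n"] g1[of "Suc n"] by (cases "s n") auto
  ultimately show "1/3 \<le> frac (3 ^ n * y) \<longleftrightarrow> s n" by simp
qed

text \<open>A point is coded by which balls of a countable base contain it; these bits are the ternary
  digits of a real number.  A Borel left inverse makes the image of every Borel set Borel, which
  replaces the Lusin--Souslin theorem throughout.\<close>

lemma borel_embedding_real:
  obtains e :: "'b::{complete_space, second_countable_topology} \<Rightarrow> real" and r :: "real \<Rightarrow> 'b"
  where "e \<in> borel_measurable borel" "r \<in> borel_measurable borel"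
    "\<And>x. r (e x) = x" "\<And>x. 0 < e x" "\<And>x. e x < 1"
proof -
  obtain D :: "'b set" where D: "countable D" "\<And>X. open X \<Longrightarrow> X \<noteq> {} \<Longrightarrow> \<exists>d\<in>D. d \<in> X"
    using countable_dense_setE by blast
  have "D \<noteq> {}" using D(2)[of UNIV] by auto
  define d where "d = from_nat_into D"
  have dD: "\<exists>i. dist x (d i) < \<epsilon>" if \<epsilon>: "\<epsilon> > 0" for x \<epsilon>
  proof -
    obtain z where "z \<in> D" "z \<in> ball x \<epsilon>" using D(2)[of "ball x \<epsilon>"] \<epsilon> by auto
    moreover have "range d = D"
      unfolding d_def using D(1) \<open>D \<noteq> {}\<close> by (simp add: range_from_nat_into)
    ultimately show ?thesis by (metis imageE mem_ball)
  qed
  \<comment> \<open>Bit \<open>n\<close> codes a pair \<open>(i, k)\<close> and tells whether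
    \<open>x\<close> lies in the ball of radius \<open>1 / 2 ^ k\<close> about
    \<open>d i\<close>.\<close>
  define s where "s x n = (dist x (d (fst (prod_decode n))) < 1 / 2 ^ snd (prod_decode n))" for x n
  \<comment> \<open>The ternary sum lies in \<open>[0, 1/2]\<close>; the affine change moves it to
    \<open>[1/2, 3/4]\<close>, strictly inside the unit interval. Decoding undoes the change by
    \<open>2 * y - 1\<close>.\<close>
  define e where "e x = (1 + (\<Sum>m. of_bool (s x m) / 3 ^ Suc m :: real)) / 2" for x
  define idx where "idx k y = (LEAST i. 1/3 \<le> frac (3 ^ prod_encode (i, k) * (2 * y - 1)))"
    for k and y :: real
  define c where "c k y = d (idx k y)" for k y
  \<comment> \<open>The centres \<open>c k y\<close> converge to \<open>x\<close> if
    \<open>y = e x\<close>. At points where they are not Cauchy, the constant default makes the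
    sequence converge all the same, so \<open>r\<close> is a pointwise limit of Borel maps
    everywhere.\<close>
  define r where "r y = lim (\<lambda>k. if Cauchy (\<lambda>k. c k y) then c k y else d 0)" for y
  have [measurable]: "(\<lambda>x. s x n) \<in> measurable borel (count_space UNIV)" for n
    unfolding s_def by measurable
  have em: "e \<in> borel_measurable borel" unfolding e_def by measurable
  have [measurable]: "frac \<in> borel_measurable (borel :: real measure)"
    unfolding frac_def[abs_def] by measurable
  have idxm[measurable]: "idx k \<in> measurable borel (count_space UNIV)" for k
    unfolding idx_def by measurable
  have cm[measurable]: "c k \<in> borel_measurable borel" for k
    unfolding c_def by (rule measurable_compose[OF idxm]) simp
  have "r \<in> borel_measurable borel"
  proof (rule borel_measurable_LIMSEQ_metric)
    show "(\<lambda>y. if Cauchy (\<lambda>k. c k y) then c k y else d 0) \<in> borel_measurable borel" for k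
      by measurable
    fix y
    have "convergent (\<lambda>k. if Cauchy (\<lambda>k. c k y) then c k y else d 0)"
      by (cases "Cauchy (\<lambda>k. c k y)") (auto simp: Cauchy_convergent_iff convergent_const)
    then show "(\<lambda>k. if Cauchy (\<lambda>k. c k y) then c k y else d 0) \<longlonglongrightarrow> r y"
      unfolding r_def by (rule convergent_LIMSEQ_iff[THEN iffD1])
  qed
  moreover have "r (e x) = x" for x
  proof -
    have "2 * ((1 + S) / 2) - 1 = S" for S :: real by (simp add: field_simps)
    then have "2 * e x - 1 = (\<Sum>m. of_bool (s x m) / 3 ^ Suc m)"
      unfolding e_def .
    then have dig: "1/3 \<le> frac (3 ^ prod_encode (i, k) * (2 * e x - 1)) \<longleftrightarrow> dist x (d i) < 1 / 2 ^ k" for i k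
      using ternary_digit(3)[of "prod_encode (i, k)" "s x"] by (simp add: s_def)
    have near: "dist x (c k (e x)) < 1 / 2 ^ k" for k
      unfolding c_def idx_def dig by (rule LeastI_ex) (use dD[of "1 / 2 ^ k" x] in auto)
    have "dist (c k (e x)) x \<le> (1/2) ^ k" for k
      using near[of k] by (simp add: dist_commute power_one_over)
    then have "(\<lambda>k. dist (c k (e x)) x) \<longlonglongrightarrow> 0"
      by (intro tendsto_sandwich[OF _ _ tendsto_const LIMSEQ_power_zero[of "1/2::real"]]) auto
    then have L: "(\<lambda>k. c k (e x)) \<longlonglongrightarrow> x" by (rule tendsto_dist_iff[THEN iffD2])
    then have "Cauchy (\<lambda>k. c k (e x))" by (rule LIMSEQ_imp_Cauchy)
    then show ?thesis unfolding r_def using limI[OF L] by simp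
  qed
  moreover have "0 < e x" "e x < 1" for x
    using ternary_digit(1,2)[of "s x"] by (simp_all add: e_def)
  ultimately show ?thesis using that em by blast
qed

section \<open>Absorption of null sets\<close>

lemma emeasure_singleton_non_atomic:
  assumes na: "non_atomic M" and x: "{x} \<in> sets M"
  shows "emeasure M {x} = 0"
proof (rule ccontr)
  assume "emeasure M {x} \<noteq> 0"
  then have "0 < emeasure M {x}" by (simp add: zero_less_iff_neq_zero)
  then obtain B where B: "B \<subseteq> {x}" "0 < emeasure M B" "emeasure M B < emeasure M {x}"
    using bspec[OF na[unfolded non_atomic_def] x] by metis
  then show False by (metis emeasure_empty less_irrefl subset_singletonD)
qed

text \<open>The embedding of the unit interval is a quantile function of the measure, pushed to the real
  line and restricted to a compact set of positive measure.\<close>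

lemma conull_contains_interval:
  fixes M :: "('a::polish_space) measure"
  assumes sM: "sets M = sets borel" and fin: "finite_measure M"
    and sing: "\<And>x. emeasure M {x} = 0" and pos: "emeasure M (space M) \<noteq> 0"
    and X0[measurable]: "X0 \<in> sets borel" and null: "emeasure M (- X0) = 0"
  obtains k :: "real \<Rightarrow> 'a" and l :: "'a \<Rightarrow> real"
  where "k \<in> borel_measurable borel" "l \<in> borel_measurable borel"
    "\<And>u. 0 < u \<Longrightarrow> u < 1 \<Longrightarrow> k u \<in> X0 \<and> l (k u) = u"
proof -
  interpret finite_measure M by fact
  have spM: "space M = UNIV" using sM by (metis sets_eq_imp_space_eq space_borel)
  obtain e :: "'a \<Rightarrow> real" and r where er[measurable]: "e \<in> borel_measurable borel" "r \<in> borel_measurable borel"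
    and re: "\<And>x. r (e x) = x" by (rule borel_embedding_real) blast
  have [measurable]: "e \<in> borel_measurable M" using er(1) sM by (simp cong: measurable_cong_sets)
  define \<nu> where "\<nu> = distr M borel e"
  have s\<nu>: "sets \<nu> = sets borel" "space \<nu> = UNIV" by (auto simp: \<nu>_def)
  interpret \<nu>: finite_measure \<nu> unfolding \<nu>_def by (rule finite_measure_distr) measurable
  \<comment> \<open>\<open>B\<close> is the image of \<open>X0\<close> under \<open>e\<close>,
    written through the left inverse so that it is visibly Borel.\<close>
  define B where "B = {y. r y \<in> X0 \<and> e (r y) = y}"
  have [measurable]: "B \<in> sets borel" unfolding B_def by measurable
  have "emeasure \<nu> B = emeasure M X0"
    unfolding \<nu>_def by (subst emeasure_distr) (auto simp: B_def re spM vimage_def)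
  also have "\<dots> \<noteq> 0"
  proof
    assume "emeasure M X0 = 0"
    then have "emeasure M (X0 \<union> - X0) = 0"
      using null sM X0 by (intro emeasure_Un_null_set[THEN trans]) (auto simp: null_sets_def)
    then show False using pos spM by simp
  qed
  finally have "0 < emeasure \<nu> B" by (simp add: zero_less_iff_neq_zero)
  moreover have "emeasure \<nu> B = (SUP K \<in> {K. K \<subseteq> B \<and> compact K}. emeasure \<nu> K)"
    by (rule inner_regular) (auto simp: s\<nu>)
  ultimately have "0 < (SUP K \<in> {K. K \<subseteq> B \<and> compact K}. emeasure \<nu> K)" by metis
  then obtain K where K: "K \<subseteq> B" "compact K" "0 < emeasure \<nu> K"
    by (auto simp: less_SUP_iff)
  have Kb: "K \<in> sets \<nu>" using compact_imp_closed[OF K(2)] s\<nu> by auto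
  define \<kappa> where "\<kappa> = density \<nu> (indicator K)"
  interpret \<kappa>: finite_borel_measure \<kappa>
    unfolding \<kappa>_def finite_borel_measure_def finite_borel_measure_axioms_def
    using \<nu>.finite_measure_restricted[OF Kb] s\<nu> by simp
  have \<kappa>m: "measure \<kappa> A = measure \<nu> (K \<inter> A)" if "A \<in> sets borel" for A
    unfolding \<kappa>_def using measure_restricted[OF Kb] that s\<nu> by simp
  define m where "m = measure \<nu> K"
  have "m > 0" using K(3) unfolding m_def by (simp add: \<nu>.emeasure_eq_measure)
  have \<kappa>sp: "measure \<kappa> (space \<kappa>) = m" using \<kappa>m[of UNIV] \<kappa>.borel_UNIV by (simp add: m_def)
  \<comment> \<open>Since \<open>e\<close> is injective, its pushforward inherits the absence of
    atoms, and so does the restriction to \<open>K\<close>.\<close>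
  have cont: "isCont (cdf \<kappa>) x" for x
  proof -
    have "emeasure \<nu> {x} = emeasure M (e -` {x})"
      unfolding \<nu>_def by (subst emeasure_distr) (auto simp: spM)
    also have "\<dots> \<le> emeasure M {r x}"
      using sM by (intro emeasure_mono) (auto simp: re)
    finally have "emeasure \<nu> {x} = 0" using sing by simp
    then have "measure \<nu> {x} = 0" by (simp add: measure_def)
    then have "measure \<kappa> {x} = 0"
      using \<kappa>m[of "{x}"] \<nu>.finite_measure_mono[of "K \<inter> {x}" "{x}"] s\<nu> by (simp add: measure_le_0_iff)
    then show ?thesis using \<kappa>.isCont_cdf by simp
  qed
  \<comment> \<open>The intermediate value theorem yields a point \<open>x\<close> that may lie
    outside \<open>K\<close>. The largest point of \<open>K\<close> below \<open>x\<close> has the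
    same value of the distribution function; it exists because \<open>K\<close> is compact.\<close>
  have ex: "\<exists>x\<in>K. cdf \<kappa> x = u" if u: "0 < u" "u < m" for u
  proof -
    obtain a where a: "cdf \<kappa> a < u"
      using order_tendstoD(2)[OF \<kappa>.cdf_lim_at_bot u(1)] by (auto simp: eventually_at_bot_linorder)
    obtain b where b: "u < cdf \<kappa> b"
      using order_tendstoD(1)[OF \<kappa>.cdf_lim_at_top, of u] u(2) \<kappa>sp
      by (auto simp: eventually_at_top_linorder)
    have "a \<le> b" using a b \<kappa>.cdf_nondecreasing[of b a] by linarith
    then obtain x where x: "cdf \<kappa> x = u"
      using IVT[of "cdf \<kappa>" a u b] a b cont by force
    let ?C = "K \<inter> {..x}"
    have C: "cdf \<kappa> x = measure \<nu> ?C" unfolding cdf_def by (rule \<kappa>m) simp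
    then have "?C \<noteq> {}" using u x by auto
    moreover have "compact ?C" using K(2) by (simp add: compact_Int_closed)
    ultimately have "\<exists>z\<in>?C. \<forall>t\<in>?C. t \<le> z" using compact_attains_sup by metis
    then obtain z where z: "z \<in> ?C" "\<And>t. t \<in> ?C \<Longrightarrow> t \<le> z" by auto
    have "K \<inter> {..z} = ?C" using z(1) z(2) by (auto intro: order_trans)
    then have "cdf \<kappa> z = u" using \<kappa>m[of "{..z}"] C x by (simp add: cdf_def)
    then show ?thesis using z by auto
  qed
  then obtain q where q: "\<And>u. 0 < u \<Longrightarrow> u < m \<Longrightarrow> q u \<in> K \<and> cdf \<kappa> (q u) = u" by metis
  obtain b where b: "\<forall>x\<in>K. \<bar>x\<bar> \<le> b"
    using compact_imp_bounded[OF K(2)] by (auto simp: bounded_iff)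
  define a where "a = - b"
  have ab: "a \<le> x \<and> x \<le> b" if "x \<in> K" for x
    using bspec[OF b that] by (simp add: a_def abs_le_iff)
  have "K \<noteq> {}" using K(3) by auto
  then have "a \<le> b" using ab by (meson ex_in_conv order_trans)
  \<comment> \<open>Any choice of quantiles is monotone, because the distribution function is a
    monotone left inverse of it. Constant continuation by bounds of \<open>K\<close> gives a
    monotone, hence Borel, function on the whole line.\<close>
  define Q where "Q u = (if u \<le> 0 then a else if u \<ge> m then b else q u)" for u
  have Qq: "Q u = q u" if "0 < u" "u < m" for u using that by (simp add: Q_def)
  have qm: "q u \<le> q v" if "u \<le> v" "0 < u" "v < m" for u v
  proof (rule ccontr)
    assume "\<not> q u \<le> q v"
    then have "cdf \<kappa> (q v) \<le> cdf \<kappa> (q u)" by (intro \<kappa>.cdf_nondecreasing) simp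
    then have "u = v" using q[of u] q[of v] that by simp
    then show False using \<open>\<not> q u \<le> q v\<close> by simp
  qed
  have "mono Q"
  proof (rule monoI)
    fix u v :: real assume "u \<le> v"
    then show "Q u \<le> Q v"
      using qm[of u v] q[of u] q[of v] ab[of "q u"] ab[of "q v"] \<open>a \<le> b\<close>
      unfolding Q_def by (smt (verit))
  qed
  then have [measurable]: "Q \<in> borel_measurable borel" by (rule borel_measurable_mono)
  have [measurable]: "cdf \<kappa> \<in> borel_measurable borel"
    by (intro borel_measurable_mono monoI \<kappa>.cdf_nondecreasing)
  show ?thesis
  \<comment> \<open>The factor \<open>m\<close>, the total mass on \<open>K\<close>, rescales the
    range of the distribution function to the unit interval.\<close>
  proof (rule that[of "\<lambda>u. r (Q (m * u))" "\<lambda>x. cdf \<kappa> (e x) / m"])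
    fix u :: real assume u: "0 < u" "u < 1"
    then have mu: "0 < m * u" "m * u < m" using \<open>m > 0\<close> by auto
    then have Q: "Q (m * u) \<in> K" "cdf \<kappa> (Q (m * u)) = m * u"
      using q Qq by metis+
    then have "Q (m * u) \<in> B" using K(1) by blast
    then have "r (Q (m * u)) \<in> X0" "e (r (Q (m * u))) = Q (m * u)" unfolding B_def by blast+
    then show "r (Q (m * u)) \<in> X0 \<and> cdf \<kappa> (e (r (Q (m * u)))) / m = u"
      using Q(2) \<open>m > 0\<close> by simp
  next
    show "(\<lambda>u. r (Q (m * u))) \<in> borel_measurable borel" by measurable
    show "(\<lambda>x. cdf \<kappa> (e x) / m) \<in> borel_measurable borel" by measurable
  qed
qed

text \<open>Hilbert's hotel along the orbits of the embedding \<open>\<theta>\<close>.\<close>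

lemma null_set_absorption:
  fixes M :: "('a::polish_space) measure" and \<theta> \<eta> :: "'a \<Rightarrow> 'a"
  assumes sM: "sets M = sets borel"
    and [measurable]: "X0 \<in> sets borel" and X0: "emeasure M (- X0) = 0"
    and [measurable]: "N \<in> sets borel" and N: "emeasure M N = 0"
    and [measurable]: "\<theta> \<in> borel_measurable borel" "\<eta> \<in> borel_measurable borel"
    and \<eta>\<theta>: "\<And>x. \<eta> (\<theta> x) = x" and \<theta>: "\<And>x. \<theta> x \<in> X0 \<inter> N"
  obtains \<sigma> \<tau> :: "'a \<Rightarrow> 'a"
  where "\<sigma> \<in> borel_measurable borel" "\<tau> \<in> borel_measurable borel"
    "\<And>x. \<sigma> x \<in> X0" "\<And>x. \<tau> (\<sigma> x) = x" "\<And>z. z \<in> X0 \<Longrightarrow> \<sigma> (\<tau> z) = z"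
    "AE x in M. \<sigma> x = x" "AE x in M. \<tau> x = x"
proof -
  \<comment> \<open>\<open>D n\<close> is the \<open>n\<close>-th image of the complement of
    \<open>X0\<close> under \<open>\<theta>\<close>; the left inverse \<open>\<eta>\<close>
    expresses it as a Borel set.\<close>
  define D where "D = rec_nat (- X0) (\<lambda>_ A. {y. \<eta> y \<in> A \<and> \<theta> (\<eta> y) = y})"
  have D0: "D 0 = - X0" and DS: "\<And>n. D (Suc n) = {y. \<eta> y \<in> D n \<and> \<theta> (\<eta> y) = y}"
    by (auto simp: D_def)
  have Dm[measurable]: "D n \<in> sets borel" for n
  proof (induction n)
    case (Suc n)
    note [measurable] = Suc
    show ?case unfolding DS by measurable
  qed (simp add: D0)
  define U where "U = (\<Union>n. D n)"
  have Um[measurable]: "U \<in> sets borel" unfolding U_def by measurable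
  have "D n \<subseteq> - X0 \<union> N" for n
  proof (cases n)
    case (Suc j)
    have "y \<in> N" if "y \<in> D (Suc j)" for y using \<theta>[of "\<eta> y"] that by (simp add: DS)
    then show ?thesis using Suc by auto
  qed (simp add: D0)
  then have "U \<subseteq> - X0 \<union> N" by (auto simp: U_def)
  moreover have "- X0 \<union> N \<in> null_sets M"
    using X0 N sM by (intro null_sets.Un) (auto simp: null_sets_def)
  ultimately have "U \<in> null_sets M" using sM null_sets_subset[of "- X0 \<union> N" M U] by simp
  then have AEU: "AE x in M. x \<notin> U" by (rule AE_not_in)
  have \<theta>U: "\<theta> x \<in> U" if x: "x \<in> U" for x
  proof -
    obtain n where "x \<in> D n" using x by (auto simp: U_def)
    then have "\<theta> x \<in> D (Suc n)" by (simp add: DS \<eta>\<theta>)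
    then show ?thesis by (auto simp: U_def)
  qed
  \<comment> \<open>A point of \<open>U\<close> inside \<open>X0\<close> is not in
    \<open>D 0\<close>, hence has a predecessor in \<open>U\<close>.\<close>
  have \<eta>U: "\<eta> z \<in> U \<and> \<theta> (\<eta> z) = z" if z: "z \<in> U" "z \<in> X0" for z
  proof -
    obtain n where n: "z \<in> D n" using z by (auto simp: U_def)
    then obtain j where "n = Suc j" using z D0 by (cases n) auto
    then show ?thesis using n DS by (auto simp: U_def)
  qed
  have X0U: "x \<in> X0" if "x \<notin> U" for x using that D0 unfolding U_def by blast
  show ?thesis
  \<comment> \<open>The map shifts \<open>D n\<close> to \<open>D (Suc n)\<close> and fixes all
    points outside \<open>U\<close>. Exactly the complement of \<open>X0\<close>, which is
    \<open>D 0\<close>, is missed.\<close>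
  proof (rule that[of "\<lambda>x. if x \<in> U then \<theta> x else x" "\<lambda>z. if z \<in> U then \<eta> z else z"])
    show "AE x in M. (if x \<in> U then \<theta> x else x) = x" using AEU by eventually_elim simp
    show "AE x in M. (if x \<in> U then \<eta> x else x) = x" using AEU by eventually_elim simp
    show "(\<lambda>x. if x \<in> U then \<theta> x else x) \<in> borel_measurable borel"
      "(\<lambda>x. if x \<in> U then \<eta> x else x) \<in> borel_measurable borel" by measurable
    show "(if x \<in> U then \<theta> x else x) \<in> X0" for x using \<theta>[of x] X0U by simp
    show "(if (if x \<in> U then \<theta> x else x) \<in> U then \<eta> (if x \<in> U then \<theta> x else x)
        else if x \<in> U then \<theta> x else x) = x" for x
      using \<theta>U[of x] \<eta>\<theta>[of x] by simp
    show "(if (if z \<in> U then \<eta> z else z) \<in> U then \<theta> (if z \<in> U then \<eta> z else z)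
        else if z \<in> U then \<eta> z else z) = z" if "z \<in> X0" for z
      using \<eta>U[OF _ that] by simp
  qed
qed

text \<open>The whole space times the reals embeds into the conull set; all but countably many slices of
  the image are null, and any null slice serves as the hotel.\<close>

lemma borel_iso_conull:
  fixes M :: "('a::polish_space) measure"
  assumes M: "standard_sf_nonatomic M" and pos: "emeasure M (space M) \<noteq> 0"
    and X0[measurable]: "X0 \<in> sets borel" and null: "emeasure M (- X0) = 0"
  obtains \<sigma> \<tau> :: "'a \<Rightarrow> 'a"
  where "\<sigma> \<in> borel_measurable borel" "\<tau> \<in> borel_measurable borel"
    "\<And>x. \<sigma> x \<in> X0" "\<And>x. \<tau> (\<sigma> x) = x" "\<And>z. z \<in> X0 \<Longrightarrow> \<sigma> (\<tau> z) = z"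
    "AE x in M. \<sigma> x = x" "AE x in M. \<tau> x = x"
proof -
  have sM: "sets M = sets borel" and sf: "sigma_finite_measure M" and na: "non_atomic M"
    using M by (auto simp: standard_sf_nonatomic_def)
  have spM: "space M = UNIV" using sM by (metis sets_eq_imp_space_eq space_borel)
  interpret sigma_finite_measure M by fact
  obtain h where h[measurable]: "h \<in> borel_measurable M" and hfin: "integral\<^sup>N M h \<noteq> \<infinity>"
    and hpos: "\<And>x. 0 < h x" using Ex_finite_integrable_function spM by auto
  \<comment> \<open>A finite measure with the same null sets as \<open>M\<close>, to which the
    embedding of the interval applies.\<close>
  define P where "P = density M h"
  have sP: "sets P = sets borel" "space P = UNIV" using sM spM by (auto simp: P_def)
  have P0: "emeasure P A = 0 \<longleftrightarrow> emeasure M A = 0" if A: "A \<in> sets borel" for A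
  proof -
    have [measurable]: "A \<in> sets M" using A sM by simp
    have "emeasure P A = 0 \<longleftrightarrow> A \<in> null_sets P" using A sP by (auto simp: null_sets_def)
    also have "\<dots> \<longleftrightarrow> (AE x in M. x \<in> A \<longrightarrow> h x = 0)"
      unfolding P_def using null_sets_density_iff[OF h, of A] by simp
    also have "\<dots> \<longleftrightarrow> (AE x in M. x \<notin> A)" using hpos by (intro AE_cong) (metis less_irrefl)
    also have "\<dots> \<longleftrightarrow> emeasure M A = 0" using AE_iff_null_sets[of A M] by (auto simp: null_sets_def)
    finally show ?thesis .
  qed
  interpret P: finite_measure P
    using hfin by (intro finite_measureI) (simp add: P_def emeasure_density)
  obtain k :: "real \<Rightarrow> 'a" and l where kl[measurable]: "k \<in> borel_measurable borel" "l \<in> borel_measurable borel"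
    and k: "\<And>u. 0 < u \<Longrightarrow> u < 1 \<Longrightarrow> k u \<in> X0 \<and> l (k u) = u"
  proof (rule conull_contains_interval[OF sP(1) P.finite_measure_axioms _ _ X0])
    show "emeasure P {x} = 0" for x
      using P0[of "{x}"] emeasure_singleton_non_atomic[OF na] sM by simp
    show "emeasure P (space P) \<noteq> 0" using P0[of UNIV] pos spM sP by simp
    show "emeasure P (- X0) = 0" using P0[of "- X0"] null by simp
  qed blast
  obtain e :: "real \<times> 'a \<Rightarrow> real" and r where er[measurable]: "e \<in> borel_measurable borel" "r \<in> borel_measurable borel"
    and re: "\<And>x. r (e x) = x" and e01: "\<And>x. 0 < e x" "\<And>x. e x < 1"
    by (rule borel_embedding_real) blast
  have r2[measurable]: "r \<in> measurable borel (borel \<Otimes>\<^sub>M borel)" using er(2) by (simp add: borel_prod)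
  have e2[measurable]: "e \<in> borel_measurable (borel \<Otimes>\<^sub>M borel)" using er(1) by (simp add: borel_prod)
  have [measurable]: "(\<lambda>x. fst (r (l x))) \<in> borel_measurable P"
    using sP by (simp cong: measurable_cong_sets)
  define Dr where "Dr = distr P borel (\<lambda>x. fst (r (l x)))"
  interpret Dr: finite_measure Dr unfolding Dr_def by (rule P.finite_measure_distr) measurable
  \<comment> \<open>A finite measure on the line has at most countably many atoms, so some slice is
    null.\<close>
  have "\<exists>a. measure Dr {a} = 0"
  proof (rule ccontr)
    assume "\<nexists>a. measure Dr {a} = 0"
    then have "{a. measure Dr {a} \<noteq> 0} = UNIV" by auto
    then show False using Dr.countable_support uncountable_UNIV_real by metis
  qed
  then obtain a where a: "measure Dr {a} = 0" by blast
  define N where "N = {x. fst (r (l x)) = a}"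
  have Nb[measurable]: "N \<in> sets borel" unfolding N_def by measurable
  have "emeasure P N = emeasure Dr {a}"
    unfolding Dr_def by (subst emeasure_distr) (auto simp: sP N_def vimage_def)
  then have N: "emeasure M N = 0" using a P0[of N] by (simp add: Dr.emeasure_eq_measure)
  \<comment> \<open>The whole space is placed in the null slice over \<open>a\<close>;
    \<open>\<eta>\<close> reads off the second coordinate.\<close>
  define \<theta> where "\<theta> x = k (e (a, x))" for x
  define \<eta> where "\<eta> z = snd (r (l z))" for z
  have m[measurable]: "\<theta> \<in> borel_measurable borel" "\<eta> \<in> borel_measurable borel"
    unfolding \<theta>_def \<eta>_def by measurable
  show ?thesis
  proof (rule null_set_absorption[OF sM X0 null Nb N m])
    show "\<eta> (\<theta> x) = x" "\<theta> x \<in> X0 \<inter> N" for x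
      using k[of "e (a, x)"] e01 re by (auto simp: \<theta>_def \<eta>_def N_def)
  qed (rule that)
qed

section \<open>Positive isometries of \<open>L\<^sup>1\<close>\<close>

text \<open>Such a \<open>p\<close> takes the place of the constant 1, which need not be
  integrable.\<close>

lemma (in sigma_finite_measure) ex_positive_integrable:
  obtains p :: "'a \<Rightarrow> real" where "integrable M p" "\<And>x. x \<in> space M \<Longrightarrow> 0 < p x"
proof -
  obtain h where [measurable]: "h \<in> borel_measurable M" and fin: "integral\<^sup>N M h \<noteq> \<infinity>"
    and pos: "\<And>x. x \<in> space M \<Longrightarrow> 0 < h x \<and> h x < \<infinity>"
    using Ex_finite_integrable_function by auto
  show ?thesis
  proof (rule that[of "\<lambda>x. enn2real (h x)"])
    have "(\<integral>\<^sup>+ x. ennreal (enn2real (h x)) \<partial>M) = integral\<^sup>N M h"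
      using pos by (intro nn_integral_cong) (simp add: less_top)
    then have "(\<integral>\<^sup>+ x. ennreal (enn2real (h x)) \<partial>M) < \<infinity>" using fin by (simp add: less_top)
    then show "integrable M (\<lambda>x. enn2real (h x))" by (intro integrableI_nonneg) auto
    show "0 < enn2real (h x)" if "x \<in> space M" for x
      using pos[OF that] by (simp add: enn2real_positive_iff)
  qed
qed

text \<open>\<open>W\<close> acts on representatives rather than on classes; \<open>W_cong\<close>
  makes it well defined on classes, and all identities hold almost everywhere.\<close>

locale positive_L1_isometry = sigma_finite_measure M
  for M :: "('a::polish_space) measure" and W :: "('a \<Rightarrow> real) \<Rightarrow> 'a \<Rightarrow> real" +
  assumes sets_M: "sets M = sets borel"
    and W_integrable [intro]: "\<And>f. integrable M f \<Longrightarrow> integrable M (W f)"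
    and W_cong: "\<And>f g. integrable M f \<Longrightarrow> integrable M g \<Longrightarrow> AE x in M. f x = g x \<Longrightarrow>
      AE x in M. W f x = W g x"
    and W_add: "\<And>f g. integrable M f \<Longrightarrow> integrable M g \<Longrightarrow>
      AE x in M. W (\<lambda>x. f x + g x) x = W f x + W g x"
    and W_scale: "\<And>f c. integrable M f \<Longrightarrow> AE x in M. W (\<lambda>x. c * f x) x = c * W f x"
    and W_norm: "\<And>f. integrable M f \<Longrightarrow> (\<integral>x. \<bar>W f x\<bar> \<partial>M) = (\<integral>x. \<bar>f x\<bar> \<partial>M)"
    and W_nonneg: "\<And>f. integrable M f \<Longrightarrow> AE x in M. 0 \<le> f x \<Longrightarrow> AE x in M. 0 \<le> W f x"
begin

section \<open>Order, lattice operations and dominated limits\<close>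

lemma W_diff:
  assumes "integrable M f" "integrable M g"
  shows "AE x in M. W (\<lambda>x. f x - g x) x = W f x - W g x"
  using W_add[OF assms(1), of "\<lambda>x. - 1 * g x"] W_scale[OF assms(2), of "- 1"] assms
  by auto

lemma W_mono:
  assumes "integrable M f" "integrable M g" "AE x in M. f x \<le> g x"
  shows "AE x in M. W f x \<le> W g x"
proof -
  have "AE x in M. 0 \<le> W (\<lambda>x. g x - f x) x"
    using assms by (intro W_nonneg) auto
  with W_diff[OF assms(2,1)] show ?thesis by eventually_elim simp
qed

text \<open>Positivity gives \<open>\<bar>W f\<bar> \<le> W \<bar>f\<bar>\<close>, and both sides have the same integral.\<close>

lemma W_abs:
  assumes f: "integrable M f"
  shows "AE x in M. W (\<lambda>x. \<bar>f x\<bar>) x = \<bar>W f x\<bar>"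
proof -
  have a: "integrable M (\<lambda>x. \<bar>f x\<bar>)" and m: "integrable M (\<lambda>x. - 1 * f x)" using f by auto
  have le: "AE x in M. \<bar>W f x\<bar> \<le> W (\<lambda>x. \<bar>f x\<bar>) x"
    using W_mono[OF f a] W_mono[OF m a] W_scale[OF f, of "- 1"] by auto
  have "(\<integral>x. W (\<lambda>x. \<bar>f x\<bar>) x - \<bar>W f x\<bar> \<partial>M) = (\<integral>x. \<bar>W (\<lambda>x. \<bar>f x\<bar>) x\<bar> \<partial>M) - (\<integral>x. \<bar>W f x\<bar> \<partial>M)"
    using W_integrable[OF f] W_integrable[OF a] le
    by (subst Bochner_Integration.integral_diff) (auto intro!: integral_cong_AE)
  also have "\<dots> = 0" using W_norm[OF f] W_norm[OF a] by simp
  finally have "AE x in M. W (\<lambda>x. \<bar>f x\<bar>) x - \<bar>W f x\<bar> = 0"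
    using W_integrable[OF f] W_integrable[OF a] le
    by (subst (asm) integral_nonneg_eq_0_iff_AE) auto
  then show ?thesis by eventually_elim simp
qed

text \<open>Minima are linear combinations of \<open>f\<close>, \<open>g\<close> and
  \<open>\<bar>f - g\<bar>\<close>, and \<open>W\<close> commutes with absolute values. The positive
  part is treated in the same way afterwards.\<close>

lemma W_min:
  assumes f: "integrable M f" and g: "integrable M g"
  shows "AE x in M. W (\<lambda>x. min (f x) (g x)) x = min (W f x) (W g x)"
proof -
  have d: "integrable M (\<lambda>x. f x - g x)" and s: "integrable M (\<lambda>x. f x + g x)" using f g by auto
  have a: "integrable M (\<lambda>x. \<bar>f x - g x\<bar>)" using d by auto
  have sd: "integrable M (\<lambda>x. f x + g x - \<bar>f x - g x\<bar>)" using s a by auto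
  have "(\<lambda>x. min (f x) (g x)) = (\<lambda>x. 1/2 * (f x + g x - \<bar>f x - g x\<bar>))"
    by (auto simp: min_def fun_eq_iff)
  then have "AE x in M. W (\<lambda>x. min (f x) (g x)) x = 1/2 * W (\<lambda>x. f x + g x - \<bar>f x - g x\<bar>) x"
    using W_scale[OF sd, of "1/2"] by simp
  with W_diff[OF s a] W_abs[OF d] W_add[OF f g] W_diff[OF f g] show ?thesis
    by eventually_elim (auto simp: min_def)
qed

lemma W_max_0:
  assumes f: "integrable M f"
  shows "AE x in M. W (\<lambda>x. max (f x) 0) x = max (W f x) 0"
proof -
  have a: "integrable M (\<lambda>x. \<bar>f x\<bar>)" using f by auto
  have s: "integrable M (\<lambda>x. f x + \<bar>f x\<bar>)" using f by auto
  have "(\<lambda>x. max (f x) 0) = (\<lambda>x. 1/2 * (f x + \<bar>f x\<bar>))" by (auto simp: max_def fun_eq_iff)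
  then have "AE x in M. W (\<lambda>x. max (f x) 0) x = 1/2 * W (\<lambda>x. f x + \<bar>f x\<bar>) x"
    using W_scale[OF s, of "1/2"] by simp
  with W_add[OF f a] W_abs[OF f] show ?thesis by eventually_elim auto
qed

text \<open>Dominated convergence makes \<open>s n\<close> tend to \<open>f\<close> in norm, so
  \<open>W (s n)\<close> tends to \<open>W f\<close> in norm because \<open>W\<close> is isometric.
  As \<open>W G\<close> dominates the images, their pointwise limit \<open>u\<close> is also a limit
  in norm, and the two limits agree.\<close>

lemma W_dominated_limit:
  assumes s: "\<And>n. integrable M (s n)" and f[measurable]: "f \<in> borel_measurable M"
    and lim: "AE x in M. (\<lambda>n. s n x) \<longlonglongrightarrow> f x"
    and G: "integrable M G" and sG: "\<And>n. AE x in M. \<bar>s n x\<bar> \<le> G x"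
    and u[measurable]: "u \<in> borel_measurable M" and Wlim: "AE x in M. (\<lambda>n. W (s n) x) \<longlonglongrightarrow> u x"
  shows "AE x in M. W f x = u x"
proof -
  have f_int: "integrable M f"
    by (rule integrable_dominated_convergence[OF f _ G lim]) (use s sG in auto)
  have [measurable]: "s n \<in> borel_measurable M" "W (s n) \<in> borel_measurable M"
      "W f \<in> borel_measurable M" for n
    using s W_integrable[OF s] W_integrable[OF f_int] by auto
  have fG: "AE x in M. \<bar>f x\<bar> \<le> G x"
  proof -
    have "AE x in M. \<forall>n. \<bar>s n x\<bar> \<le> G x" using sG by (simp add: AE_all_countable)
    with lim show ?thesis
    proof eventually_elim
      case (elim x)
      show ?case by (rule LIMSEQ_le_const2[OF tendsto_rabs[OF elim(1)]]) (use elim(2) in auto)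
    qed
  qed
  have "(\<lambda>n. \<integral>x. \<bar>s n x - f x\<bar> \<partial>M) \<longlonglongrightarrow> (\<integral>x. 0 \<partial>M)"
  proof (rule integral_dominated_convergence[where w="\<lambda>x. 2 * G x"])
    show "AE x in M. (\<lambda>n. \<bar>s n x - f x\<bar>) \<longlonglongrightarrow> 0"
      using lim
    proof eventually_elim
      case (elim x)
      show ?case using tendsto_rabs[OF tendsto_diff[OF elim tendsto_const[of "f x"]]] by simp
    qed
    show "AE x in M. norm \<bar>s n x - f x\<bar> \<le> 2 * G x" for n
      using sG[of n] fG by eventually_elim auto
  qed (use G in auto)
  moreover have "(\<integral>x. \<bar>s n x - f x\<bar> \<partial>M) = (\<integral>x. \<bar>W (s n) x - W f x\<bar> \<partial>M)" for n
  proof -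
    have "(\<integral>x. \<bar>s n x - f x\<bar> \<partial>M) = (\<integral>x. \<bar>W (\<lambda>x. s n x - f x) x\<bar> \<partial>M)"
      using s f_int by (intro W_norm[symmetric]) auto
    also have "\<dots> = (\<integral>x. \<bar>W (s n) x - W f x\<bar> \<partial>M)"
      using W_diff[OF s f_int, of n] W_integrable[of "\<lambda>x. s n x - f x"] s f_int
      by (intro integral_cong_AE) auto
    finally show ?thesis .
  qed
  ultimately have 0: "(\<lambda>n. \<integral>x. \<bar>W (s n) x - W f x\<bar> \<partial>M) \<longlonglongrightarrow> 0" by simp
  have WsG: "AE x in M. \<bar>W (s n) x\<bar> \<le> W G x" for n
    using W_abs[OF s[of n]] W_mono[OF integrable_abs[OF s[of n]] G sG] by eventually_elim simp
  have WfG: "AE x in M. \<bar>W f x\<bar> \<le> W G x"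
    using W_abs[OF f_int] W_mono[OF integrable_abs[OF f_int] G fG] by eventually_elim simp
  have uG: "AE x in M. \<bar>u x\<bar> \<le> W G x"
  proof -
    have "AE x in M. \<forall>n. \<bar>W (s n) x\<bar> \<le> W G x" using WsG by (simp add: AE_all_countable)
    with Wlim show ?thesis
    proof eventually_elim
      case (elim x)
      show ?case by (rule LIMSEQ_le_const2[OF tendsto_rabs[OF elim(1)]]) (use elim(2) in auto)
    qed
  qed
  have u_int: "integrable M u"
    by (rule Bochner_Integration.integrable_bound[OF W_integrable[OF G]]) (use uG in auto)
  have "(\<lambda>n. \<integral>x. \<bar>W (s n) x - W f x\<bar> \<partial>M) \<longlonglongrightarrow> (\<integral>x. \<bar>u x - W f x\<bar> \<partial>M)"
  proof (rule integral_dominated_convergence[where w="\<lambda>x. 2 * W G x"])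
    show "AE x in M. (\<lambda>n. \<bar>W (s n) x - W f x\<bar>) \<longlonglongrightarrow> \<bar>u x - W f x\<bar>"
      using Wlim by eventually_elim (intro tendsto_intros)
    show "AE x in M. norm \<bar>W (s n) x - W f x\<bar> \<le> 2 * W G x" for n
      using WsG[of n] WfG by eventually_elim auto
  qed (use W_integrable[OF G] in auto)
  then have "(\<integral>x. \<bar>u x - W f x\<bar> \<partial>M) = 0" using 0 LIMSEQ_unique by blast
  then have "AE x in M. \<bar>u x - W f x\<bar> = 0"
    using u_int W_integrable[OF f_int] by (subst (asm) integral_nonneg_eq_0_iff_AE) auto
  then show ?thesis by eventually_elim simp
qed

text \<open>This writes a superlevel indicator with weight \<open>q\<close> as a limit of
  expressions in \<open>q\<close> and \<open>q * y\<close> that use only operations preserved by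
  \<open>W\<close>. It serves on both sides of the representation, with \<open>q = p x\<close>,
  \<open>y = \<iota> x\<close> and with \<open>q = w0 x\<close>, \<open>y = t x\<close>.\<close>

lemma truncation_limit:
  fixes q :: real
  assumes "0 \<le> q"
  shows "(\<lambda>n. min q (real n * max (q * y - c * q) 0)) \<longlonglongrightarrow> q * indicator {c<..} y"
proof (cases "q > 0 \<and> c < y")
  case True
  then have d: "q * y - c * q > 0" by (simp add: mult.commute)
  obtain N where N: "q \<le> real N * (q * y - c * q)"
    using reals_Archimedean3[OF d] less_imp_le by blast
  have "\<forall>\<^sub>F n in sequentially. min q (real n * max (q * y - c * q) 0) = q"
    using eventually_ge_at_top[of N]
  proof eventually_elim
    case (elim n)
    then have "real N * (q * y - c * q) \<le> real n * (q * y - c * q)"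
      using d by (intro mult_right_mono) auto
    then have "min q (real n * (q * y - c * q)) = q" using N by linarith
    then show ?case using d by (simp add: max_def)
  qed
  then show ?thesis using True by (simp add: tendsto_eventually)
next
  case False
  then have le: "q * y - c * q \<le> 0" and 0: "q * indicator {c<..} y = 0"
    using assms by (cases "q = 0"; auto simp: mult.commute)+
  then show ?thesis unfolding 0 using assms by (simp add: max_def min_def)
qed

section \<open>Representation by weighted composition\<close>

definition represented_by :: "('a \<Rightarrow> 'a) \<Rightarrow> ('a \<Rightarrow> real) \<Rightarrow> bool" where
  "represented_by T w \<longleftrightarrow> T \<in> measurable M M \<and> w \<in> borel_measurable M \<and> (\<forall>x. 0 \<le> w x) \<and>
    (\<forall>h. integrable M h \<longrightarrow> (AE x in M. W h x = h (T x) * w x))"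

lemma represented_byD:
  assumes "represented_by T w"
  shows "T \<in> measurable M M" "w \<in> borel_measurable M" "0 \<le> w x"
    "integrable M h \<Longrightarrow> AE x in M. W h x = h (T x) * w x"
  using assms by (auto simp: represented_by_def)

text \<open>With \<open>\<iota>\<close> a Borel embedding into the unit interval and \<open>p\<close> a positive integrable function,
  \<open>\<iota> \<circ> T\<close> must be \<open>t = W (p \<iota>) / W p\<close>: since \<open>W\<close> preserves minima and monotone limits, it maps
  \<open>p\<close> restricted to \<open>{\<iota> > c}\<close> to \<open>W p\<close> restricted to \<open>{t > c}\<close>.\<close>

lemma ex_represented_by: "\<exists>T w. represented_by T w"
proof -
  have spM: "space M = UNIV" using sets_M by (metis sets_eq_imp_space_eq space_borel)
  obtain p :: "'a \<Rightarrow> real" where p_int: "integrable M p" and "\<And>x. x \<in> space M \<Longrightarrow> 0 < p x"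
    by (rule ex_positive_integrable) blast
  then have p_pos: "0 < p x" for x using spM by simp
  have [measurable]: "p \<in> borel_measurable M" using p_int by simp
  have pb: "integrable M (\<lambda>x. p x * g x)" if [measurable]: "g \<in> borel_measurable M"
    and "\<And>x. \<bar>g x\<bar> \<le> 1" for g
    by (rule Bochner_Integration.integrable_bound[OF p_int])
      (use that(2) p_pos in \<open>auto simp: abs_mult mult_left_le less_imp_le\<close>)
  obtain \<iota> :: "'a \<Rightarrow> real" and r where er: "\<iota> \<in> borel_measurable borel" "r \<in> borel_measurable borel"
    and r\<iota>: "\<And>x. r (\<iota> x) = x" and \<iota>01: "\<And>x. 0 < \<iota> x" "\<And>x. \<iota> x < 1"
    by (rule borel_embedding_real) blast
  have [measurable]: "\<iota> \<in> borel_measurable M" "r \<in> measurable borel M"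
    using er sets_M by (simp_all cong: measurable_cong_sets)
  have p\<iota>: "integrable M (\<lambda>x. p x * \<iota> x)"
    using \<iota>01 by (intro pb) (auto simp: abs_le_iff less_imp_le intro: order_trans[of _ 0])
  define w0 where "w0 = W p"
  define a where "a = W (\<lambda>x. p x * \<iota> x)"
  define t where "t x = a x / w0 x" for x
  have [measurable]: "w0 \<in> borel_measurable M" "a \<in> borel_measurable M"
    using W_integrable[OF p_int] W_integrable[OF p\<iota>] by (auto simp: w0_def a_def)
  have [measurable]: "t \<in> borel_measurable M" unfolding t_def by measurable
  have w0: "AE x in M. 0 \<le> w0 x"
    unfolding w0_def using p_pos by (intro W_nonneg p_int) (auto intro: less_imp_le)
  have a_nonneg: "AE x in M. 0 \<le> a x"
    unfolding a_def using p_pos \<iota>01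
    by (intro W_nonneg p\<iota> AE_I2) (simp add: less_imp_le)
  have a_le: "AE x in M. a x \<le> w0 x"
    unfolding a_def w0_def using p_pos \<iota>01
    by (intro W_mono p\<iota> p_int AE_I2) (simp add: less_imp_le mult_left_le)
  \<comment> \<open>Where \<open>w0\<close> vanishes, \<open>a\<close> vanishes too, so the value 0
    of the quotient \<open>t\<close> does no harm there.\<close>
  have at: "AE x in M. a x = w0 x * t x"
    using w0 a_nonneg a_le by eventually_elim (auto simp: t_def)
  have level: "AE x in M. W (\<lambda>x. p x * indicator {c<..} (\<iota> x)) x = w0 x * indicator {c<..} (t x)" for c
  proof -
    define s where "s n x = min (p x) (real n * max (p x * \<iota> x - c * p x) 0)" for n :: nat and x
    have i1: "integrable M (\<lambda>x. p x * \<iota> x - c * p x)" using p\<iota> p_int by auto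
    have i2: "integrable M (\<lambda>x. max (p x * \<iota> x - c * p x) 0)" using i1 by auto
    have i3: "integrable M (\<lambda>x. real n * max (p x * \<iota> x - c * p x) 0)" for n :: nat
      using i2 by auto
    have s_int: "integrable M (s n)" for n unfolding s_def using p_int i3 by auto
    have Ws: "AE x in M. W (s n) x = min (w0 x) (real n * max (w0 x * t x - c * w0 x) 0)" for n
      using W_min[OF p_int i3[of n]] W_scale[OF i2, of "real n"] W_max_0[OF i1]
        W_diff[OF p\<iota> integrable_mult_right[OF p_int], of c] W_scale[OF p_int, of c] at
      unfolding s_def a_def w0_def by eventually_elim simp
    show ?thesis
    proof (rule W_dominated_limit[of s _ p])
      show "AE x in M. (\<lambda>n. s n x) \<longlonglongrightarrow> p x * indicator {c<..} (\<iota> x)"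
        unfolding s_def using p_pos by (auto intro!: truncation_limit less_imp_le)
      have "AE x in M. \<forall>n. W (s n) x = min (w0 x) (real n * max (w0 x * t x - c * w0 x) 0)"
        using Ws by (simp add: AE_all_countable)
      with w0 show "AE x in M. (\<lambda>n. W (s n) x) \<longlonglongrightarrow> w0 x * indicator {c<..} (t x)"
        by eventually_elim (simp add: truncation_limit)
      show "AE x in M. \<bar>s n x\<bar> \<le> p x" for n
        using p_pos by (auto simp: s_def abs_le_iff min_def less_imp_le intro: order_trans[of _ 0])
    qed (use s_int p_int in measurable)
  qed
  have sets_Ioi: "sets (borel :: real measure) = sigma_sets UNIV (range greaterThan)"
    by (subst borel_Ioi) (simp add: sets_measure_of)
  \<comment> \<open>Open half-lines form an intersection-stable generator. Complements follow from
    linearity, and disjoint unions from finite partial unions with a dominated limit.\<close>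
  have real_sets: "AE x in M. W (\<lambda>x. p x * indicator B (\<iota> x)) x = w0 x * indicator B (t x)"
    if B: "B \<in> sets borel" for B :: "real set"
  proof -
    have "{a<..} \<inter> {b<..} = {max a b<..}" for a b :: real by auto
    then have "Int_stable (range (greaterThan :: real \<Rightarrow> real set))"
      by (auto simp: Int_stable_def)
    moreover have "range (greaterThan :: real \<Rightarrow> real set) \<subseteq> Pow UNIV" by simp
    moreover have "B \<in> sigma_sets UNIV (range greaterThan)" using B by (simp only: sets_Ioi)
    ultimately show ?thesis
    proof (induction rule: sigma_sets_induct_disjoint)
      case (basic A)
      then show ?case using level by auto
    next
      case empty
      show ?case using W_scale[OF p_int, of 0] by simp
    next
      case (compl A)
      have [measurable]: "A \<in> sets borel" using compl(1) by (simp add: sets_Ioi)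
      have i: "integrable M (\<lambda>x. p x * indicator A (\<iota> x))"
        by (intro pb) (auto simp: indicator_def)
      have "(\<lambda>x. p x * indicator (UNIV - A) (\<iota> x)) = (\<lambda>x. p x - p x * indicator A (\<iota> x))"
        by (auto simp: fun_eq_iff indicator_def)
      then have "AE x in M. W (\<lambda>x. p x * indicator (UNIV - A) (\<iota> x)) x =
          w0 x - W (\<lambda>x. p x * indicator A (\<iota> x)) x"
        using W_diff[OF p_int i] by (simp add: w0_def)
      with compl(2) show ?case by eventually_elim (auto simp: indicator_def)
    next
      case (union A)
      have Am[measurable]: "A i \<in> sets borel" for i using union(2) by (auto simp: sets_Ioi)
      have i: "integrable M (\<lambda>x. p x * indicator B (\<iota> x))" if [measurable]: "B \<in> sets borel" for B
        by (intro pb) (auto simp: indicator_def)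
      define U where "U n = (\<Union>i<n. A i)" for n :: nat
      have Um[measurable]: "U n \<in> sets borel" for n unfolding U_def by measurable
      have WU: "AE x in M. W (\<lambda>x. p x * indicator (U n) (\<iota> x)) x = w0 x * indicator (U n) (t x)" for n
      proof (induction n)
        case 0
        show ?case using W_scale[OF p_int, of 0] by (simp add: U_def)
      next
        case (Suc n)
        have "U n \<inter> A n = {}"
          using union(1) unfolding U_def disjoint_family_on_def by (blast dest: less_imp_neq)
        then have ind: "indicator (U (Suc n)) y = indicator (U n) y + (indicator (A n) y :: real)" for y
          unfolding U_def lessThan_Suc by (auto simp: indicator_def)
        show ?case
          unfolding ind distrib_left
          using W_add[OF i[OF Um[of n]] i[OF Am[of n]]] Suc union(3)[of n] by eventually_elim simp
      qed
      have [measurable]: "\<Union> (range A) \<in> sets borel" by measurable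
      show ?case
      proof (rule W_dominated_limit[of "\<lambda>n x. p x * indicator (U n) (\<iota> x)" _ p])
        show "AE x in M. (\<lambda>n. p x * indicator (U n) (\<iota> x)) \<longlonglongrightarrow> p x * indicator (\<Union> (range A)) (\<iota> x)"
          unfolding U_def by (intro AE_I2 tendsto_intros LIMSEQ_indicator_UN)
        have "AE x in M. \<forall>n. W (\<lambda>x. p x * indicator (U n) (\<iota> x)) x = w0 x * indicator (U n) (t x)"
          using WU by (simp add: AE_all_countable)
        then show "AE x in M. (\<lambda>n. W (\<lambda>x. p x * indicator (U n) (\<iota> x)) x) \<longlonglongrightarrow>
            w0 x * indicator (\<Union> (range A)) (t x)"
          by eventually_elim (simp add: U_def tendsto_intros LIMSEQ_indicator_UN)
        show "AE x in M. \<bar>p x * indicator (U n) (\<iota> x)\<bar> \<le> p x" for n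
          using p_pos by (auto simp: indicator_def less_imp_le)
      qed (use i p_int in measurable)
    qed
  qed
  \<comment> \<open>As \<open>r\<close> inverts \<open>\<iota>\<close>, a set \<open>A\<close> is
    \<open>{x. \<iota> x \<in> r -\<close> followed by \<open>A}\<close>; thus the identity for real
    Borel sets becomes one for Borel sets of the space.\<close>
  define T where "T x = r (t x)" for x
  have T[measurable]: "T \<in> measurable M M" unfolding T_def by measurable
  have sets: "AE x in M. W (\<lambda>x. p x * indicator A x) x = w0 x * indicator A (T x)"
    if [measurable]: "A \<in> sets M" for A
  proof -
    have "r -` A \<in> sets borel" using measurable_sets[of r borel M A] by simp
    from real_sets[OF this] show ?thesis by (simp add: indicator_def r\<iota> T_def)
  qed
  \<comment> \<open>A function \<open>g\<close> is integrable for \<open>?N\<close> exactly if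
    \<open>p * g\<close> is integrable for \<open>M\<close>, so induction over integrable functions
    passes from indicators to all \<open>g\<close>.\<close>
  let ?N = "density M p"
  have N_int: "integrable ?N f \<longleftrightarrow> integrable M (\<lambda>x. p x * f x)" if "f \<in> borel_measurable M" for f :: "'a \<Rightarrow> real"
    using that p_pos by (subst integrable_density) (auto simp: less_imp_le)
  have N_meas: "f \<in> borel_measurable M" if "integrable ?N f" for f :: "'a \<Rightarrow> real"
    using borel_measurable_integrable[OF that] by simp
  have N_mult: "integrable M (\<lambda>x. p x * f x)" if "integrable ?N f" for f :: "'a \<Rightarrow> real"
    using N_int[OF N_meas[OF that]] that by simp
  have gen: "AE x in M. W (\<lambda>x. p x * g x) x = w0 x * g (T x)" if "integrable ?N g" for g :: "'a \<Rightarrow> real"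
    using that
  proof (induction rule: integrable_induct)
    case (base A c)
    then have A[measurable]: "A \<in> sets M" by simp
    have "integrable M (\<lambda>x. p x * indicator A x)" by (intro pb) (auto simp: indicator_def)
    then have "AE x in M. W (\<lambda>x. c * (p x * indicator A x)) x = c * W (\<lambda>x. p x * indicator A x) x"
      by (rule W_scale)
    moreover have "(\<lambda>x. c * (p x * indicator A x)) = (\<lambda>x. p x * (indicator A x *\<^sub>R c))"
      by (simp add: fun_eq_iff ac_simps)
    ultimately have "AE x in M. W (\<lambda>x. p x * (indicator A x *\<^sub>R c)) x = c * W (\<lambda>x. p x * indicator A x) x"
      by simp
    with sets[OF A] show ?case by eventually_elim simp
  next
    case (add f g)
    from W_add[OF N_mult[OF add.hyps(1)] N_mult[OF add.hyps(2)]] add.IH show ?case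
      unfolding distrib_left by eventually_elim simp
  next
    case (lim f s)
    have [measurable]: "f \<in> borel_measurable M" "\<And>n. s n \<in> borel_measurable M"
      by (rule N_meas, rule lim.hyps)+
    show ?case
    \<comment> \<open>The factor 2 comes from the bound \<open>2 * \<bar>f x\<bar>\<close> on the
      approximations in the induction rule.\<close>
    proof (rule W_dominated_limit[of "\<lambda>n x. p x * s n x" _ "\<lambda>x. 2 * (p x * \<bar>f x\<bar>)"])
      show "integrable M (\<lambda>x. p x * s n x)" for n by (rule N_mult, rule lim.hyps)
      show "AE x in M. (\<lambda>n. p x * s n x) \<longlonglongrightarrow> p x * f x"
        using lim.hyps(2) spM by (intro AE_I2 tendsto_intros) auto
      show "integrable M (\<lambda>x. 2 * (p x * \<bar>f x\<bar>))"
        by (intro integrable_mult_right N_mult integrable_abs lim.hyps)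
      show "AE x in M. \<bar>p x * s n x\<bar> \<le> 2 * (p x * \<bar>f x\<bar>)" for n
      proof (rule AE_I2)
        fix x
        have "\<bar>s n x\<bar> \<le> 2 * \<bar>f x\<bar>" using lim.hyps(3)[of x n] spM by simp
        then have "p x * \<bar>s n x\<bar> \<le> p x * (2 * \<bar>f x\<bar>)" using p_pos[of x] by (intro mult_left_mono) auto
        then show "\<bar>p x * s n x\<bar> \<le> 2 * (p x * \<bar>f x\<bar>)" using p_pos[of x] by (simp add: abs_mult)
      qed
      have "AE x in M. \<forall>n. W (\<lambda>x. p x * s n x) x = w0 x * s n (T x)"
        using lim.IH by (simp add: AE_all_countable)
      then show "AE x in M. (\<lambda>n. W (\<lambda>x. p x * s n x) x) \<longlonglongrightarrow> w0 x * f (T x)"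
        by eventually_elim (use lim.hyps(2) spM in \<open>auto intro!: tendsto_intros\<close>)
    qed measurable
  qed
  \<comment> \<open>The previous formula is applied to \<open>h / p\<close>. Taking
    \<open>max 0\<close> changes \<open>w0\<close> on a null set only and makes the weight
    nonnegative everywhere.\<close>
  have "AE x in M. W h x = h (T x) * (max 0 (w0 x) / p (T x))" if h: "integrable M h" for h
  proof -
    from h have [measurable]: "h \<in> borel_measurable M" by auto
    have "(\<lambda>x. p x * (h x / p x)) = h" using p_pos by (auto simp: fun_eq_iff less_imp_neq[symmetric])
    then have "integrable ?N (\<lambda>x. h x / p x)" using h by (subst N_int) simp_all
    from gen[OF this] w0 show ?thesis 
      unfolding \<open>(\<lambda>x. p x * (h x / p x)) = h\<close> by eventually_elim simp
  qed
  moreover have "0 \<le> max 0 (w0 x) / p (T x)" for x using p_pos[of "T x"] by simp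
  moreover have "(\<lambda>x. max 0 (w0 x) / p (T x)) \<in> borel_measurable M" by measurable
  ultimately have "represented_by T (\<lambda>x. max 0 (w0 x) / p (T x))"
    using T by (simp add: represented_by_def)
  then show ?thesis by blast
qed

text \<open>On a set \<open>C\<close> of finite measure this is the isometry property for the
  indicator: the norm of \<open>W (indicator C)\<close> is the mass that \<open>w\<close> gives to
  the preimage of \<open>C\<close>. Exhaustion by sets of finite measure gives the rest.\<close>

lemma distr_density_weight:
  assumes R: "represented_by T w"
  shows "distr (density M w) M T = M"
proof -
  note [measurable] = represented_byD(1,2)[OF R]
  note w0 = represented_byD(3)[OF R] and Ww = represented_byD(4)[OF R]
  show ?thesis
  proof (rule measure_eqI)
    fix A assume "A \<in> sets (distr (density M w) M T)"
    then have A[measurable]: "A \<in> sets M" by simp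
    obtain B :: "nat \<Rightarrow> 'a set" where B: "range B \<subseteq> sets M" "(\<Union>i. B i) = space M"
      "\<And>i. emeasure M (B i) \<noteq> \<infinity>" "incseq B"
      using sigma_finite_incseq by blast
    have Bm[measurable]: "B i \<in> sets M" for i using B(1) by auto
    have fin: "emeasure (distr (density M w) M T) C = emeasure M C"
      if [measurable]: "C \<in> sets M" and "emeasure M C < \<infinity>" for C
    proof -
      have i: "integrable M (indicator C :: 'a \<Rightarrow> real)" using that by (simp add: integrable_indicator_iff)
      have "emeasure (distr (density M w) M T) C = (\<integral>\<^sup>+x. ennreal (w x) * indicator (T -` C \<inter> space M) x \<partial>M)"
        by (simp add: emeasure_distr emeasure_density)
      also have "\<dots> = (\<integral>\<^sup>+x. ennreal \<bar>W (indicator C) x\<bar> \<partial>M)"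
      proof (rule nn_integral_cong_AE)
        from Ww[OF i] AE_space show "AE x in M. ennreal (w x) * indicator (T -` C \<inter> space M) x =
            ennreal \<bar>W (indicator C) x\<bar>"
          by eventually_elim (use w0 in \<open>auto simp: indicator_def\<close>)
      qed
      also have "\<dots> = ennreal (\<integral>x. \<bar>W (indicator C) x\<bar> \<partial>M)"
        using W_integrable[OF i] by (intro nn_integral_eq_integral) auto
      also have "\<dots> = ennreal (measure M C)" unfolding W_norm[OF i] by simp
      also have "\<dots> = emeasure M C" using that(2) by (simp add: emeasure_eq_ennreal_measure less_top)
      finally show ?thesis .
    qed
    have inc: "incseq (\<lambda>i. A \<inter> B i)" using B(4) by (auto simp: incseq_def)
    have UA: "(\<Union>i. A \<inter> B i) = A" using B(2) sets.sets_into_space[OF A] by auto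
    have "emeasure (distr (density M w) M T) (A \<inter> B i) = emeasure M (A \<inter> B i)" for i
      using B(3)[of i] emeasure_mono[of "A \<inter> B i" "B i" M] by (intro fin) (auto simp: less_top top_unique)
    then have "(SUP i. emeasure (distr (density M w) M T) (A \<inter> B i)) = (SUP i. emeasure M (A \<inter> B i))" by simp
    then show "emeasure (distr (density M w) M T) A = emeasure M A"
      using SUP_emeasure_incseq[OF _ inc, of M] SUP_emeasure_incseq[OF _ inc, of "distr (density M w) M T"]
      unfolding UA by (simp add: image_subset_iff)
  qed simp
qed

section \<open>Positivity of the weight and invertible point maps\<close>

lemma weight_pos:
  assumes R: "represented_by T w"
    and surj: "\<forall>h. integrable M h \<longrightarrow> (\<exists>g. integrable M g \<and> (AE x in M. W g x = h x))"
  shows "AE x in M. 0 < w x"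
proof -
  obtain p :: "'a \<Rightarrow> real" where p: "integrable M p" "\<And>x. x \<in> space M \<Longrightarrow> 0 < p x"
    by (rule ex_positive_integrable) blast
  obtain g where g: "integrable M g" "AE x in M. W g x = p x" using surj p(1) by blast
  \<comment> \<open>A zero of \<open>w\<close> would be a zero of \<open>W g\<close>, which equals
    the strictly positive \<open>p\<close>.\<close>
  from represented_byD(4)[OF R g(1)] g(2) AE_space show ?thesis
  proof eventually_elim
    case (elim x)
    then have "0 < g (T x) * w x" using p(2)[of x] by simp
    then show ?case using represented_byD(3)[OF R, of x] by (cases "w x = 0") auto
  qed
qed

text \<open>Since \<open>T\<close> carries \<open>density M w\<close> to \<open>M\<close>, preimages
  of null sets are null for \<open>density M w\<close>, and a positive weight makes them null for
  \<open>M\<close>.\<close>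

lemma AE_compose_weight:
  assumes R: "represented_by T w" and w_pos: "AE x in M. 0 < w x"
    and P: "AE x in M. P x"
  shows "AE x in M. P (T x)"
proof -
  note [measurable] = represented_byD(1,2)[OF R]
  have "AE x in distr (density M w) M T. P x"
    unfolding distr_density_weight[OF R] by (rule P)
  then have "AE x in density M w. P (T x)" by (rule AE_distrD[rotated]) simp
  then have "AE x in M. 0 < ennreal (w x) \<longrightarrow> P (T x)" by (subst (asm) AE_density) auto
  with w_pos show ?thesis by eventually_elim (simp add: ennreal_less_zero_iff)
qed

text \<open>Composing the two representations gives
  \<open>h (T' (T x)) * (w' (T x) * w x) = h x\<close>. Comparing the cases \<open>h = p\<close> and
  \<open>h = p * \<iota>\<close> cancels the weights and leaves
  \<open>\<iota> (T' (T x)) = \<iota> x\<close>, where \<open>\<iota>\<close> is injective.\<close>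

lemma composition_inverse:
  assumes "positive_L1_isometry M W'"
    and inv: "\<forall>h. integrable M h \<longrightarrow> (AE x in M. W (W' h) x = h x)"
    and R: "represented_by T w" and R': "positive_L1_isometry.represented_by M W' T' w'"
  shows "AE x in M. 0 < w x" "AE x in M. T' (T x) = x"
proof -
  interpret W': positive_L1_isometry M W' by fact
  show w_pos: "AE x in M. 0 < w x"
    by (rule weight_pos[OF R]) (use inv W'.W_integrable in blast)
  have comp: "AE x in M. h (T' (T x)) * (w' (T x) * w x) = h x" if h: "integrable M h" for h
  proof -
    have "AE x in M. W' h (T x) = h (T' (T x)) * w' (T x)"
      by (rule AE_compose_weight[OF R w_pos W'.represented_byD(4)[OF R' h]])
    with represented_byD(4)[OF R W'.W_integrable[OF h]] inv[rule_format, OF h] show ?thesis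
      by eventually_elim (simp add: ac_simps)
  qed
  obtain p :: "'a \<Rightarrow> real" where p_int: "integrable M p" and p_pos: "\<And>x. x \<in> space M \<Longrightarrow> 0 < p x"
    by (rule ex_positive_integrable) blast
  have [measurable]: "p \<in> borel_measurable M" using p_int by simp
  obtain \<iota> :: "'a \<Rightarrow> real" and r :: "real \<Rightarrow> 'a" where \<iota>: "\<iota> \<in> borel_measurable borel"
    and r\<iota>: "\<And>x. r (\<iota> x) = x" and \<iota>01: "\<And>x. 0 < \<iota> x" "\<And>x. \<iota> x < 1"
    by (rule borel_embedding_real) blast
  have [measurable]: "\<iota> \<in> borel_measurable M"
    using \<iota> sets_M by (simp cong: measurable_cong_sets)
  have p\<iota>: "integrable M (\<lambda>x. p x * \<iota> x)"
  proof (rule Bochner_Integration.integrable_bound[OF p_int])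
    have "norm (p x * \<iota> x) \<le> norm (p x)" for x
      using \<iota>01[of x] by (simp add: abs_mult mult_left_le less_imp_le)
    then show "AE x in M. norm (p x * \<iota> x) \<le> norm (p x)" by simp
  qed measurable
  from comp[OF p_int] comp[OF p\<iota>] AE_space show "AE x in M. T' (T x) = x"
  proof eventually_elim
    case (elim x)
    have "p x * \<iota> (T' (T x)) = p (T' (T x)) * (w' (T x) * w x) * \<iota> (T' (T x))" using elim(1) by simp
    also have "\<dots> = p x * \<iota> x" using elim(2) by (simp add: ac_simps)
    finally have "\<iota> (T' (T x)) = \<iota> x" using p_pos[OF elim(3)] by simp
    then show ?case by (metis r\<iota>)
  qed
qed

text \<open>\<open>T\<close> restricts to a bijection from \<open>Y0\<close>, where
  \<open>T' \<circ> T\<close> is the identity, onto \<open>X0\<close>, where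
  \<open>T \<circ> T'\<close> is. Both sets are conull, so Borel isomorphisms with the whole space
  turn this restriction into an everywhere defined bijection.\<close>

lemma point_realization:
  assumes M: "standard_sf_nonatomic M" and W': "positive_L1_isometry M W'"
    and inv: "\<forall>h. integrable M h \<longrightarrow> (AE x in M. W (W' h) x = h x)"
      "\<forall>h. integrable M h \<longrightarrow> (AE x in M. W' (W h) x = h x)"
  obtains S T w where "S \<in> measurable M M" "\<And>x. T (S x) = x" "\<And>x. S (T x) = x"
    "represented_by T w" "AE x in M. 0 < w x"
proof (cases "emeasure M (space M) = 0")
  \<comment> \<open>For the zero measure every almost everywhere statement holds, so the identity
    serves.\<close>
  case True
  then have AE: "AE x in M. P x" for P by (intro AE_I[of _ _ "space M"]) auto
  show ?thesis
    by (rule that[of "\<lambda>x. x" "\<lambda>x. x" "\<lambda>_. 1"]) (simp_all add: AE represented_by_def)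
next
  case False
  interpret W': positive_L1_isometry M W' by fact
  obtain T w where R: "represented_by T w" using ex_represented_by by blast
  obtain T' w' where R': "W'.represented_by T' w'" using W'.ex_represented_by by blast
  note c = composition_inverse[OF W' inv(1) R R']
  note c' = W'.composition_inverse[OF positive_L1_isometry_axioms inv(2) R' R]
  have mM: "measurable M M = measurable borel borel"
    by (rule measurable_cong_sets[OF sets_M sets_M])
  have [measurable]: "T \<in> borel_measurable borel" "T' \<in> borel_measurable borel"
    using represented_byD(1)[OF R] W'.represented_byD(1)[OF R'] by (simp_all only: mM)
  have null: "emeasure M (- {x. P x}) = 0" if "AE x in M. P x" "{x. P x} \<in> sets borel" for P
  proof -
    have "- {x. P x} \<in> sets M" using that(2) sets_M by auto
    then have "- {x. P x} \<in> null_sets M" using that(1) by (subst AE_iff_null_sets) auto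
    then show ?thesis by auto
  qed
  define X0 where "X0 = {x. T (T' x) = x}"
  define Y0 where "Y0 = {x. T' (T x) = x}"
  have X0b: "X0 \<in> sets borel" and Y0b: "Y0 \<in> sets borel" unfolding X0_def Y0_def by measurable
  have X0n: "emeasure M (- X0) = 0" and Y0n: "emeasure M (- Y0) = 0"
    using null[OF c(2)] null[OF c'(2)] X0b Y0b by (simp_all add: X0_def Y0_def)
  obtain \<sigma> \<tau> where \<sigma>m[measurable]: "\<sigma> \<in> borel_measurable borel" "\<tau> \<in> borel_measurable borel"
    and \<sigma>: "\<And>x. \<sigma> x \<in> X0" "\<And>x. \<tau> (\<sigma> x) = x" "\<And>z. z \<in> X0 \<Longrightarrow> \<sigma> (\<tau> z) = z"
      "AE x in M. \<tau> x = x"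
    by (rule borel_iso_conull[OF M False X0b X0n]) blast
  obtain \<sigma>' \<tau>' where \<sigma>m'[measurable]: "\<sigma>' \<in> borel_measurable borel" "\<tau>' \<in> borel_measurable borel"
    and \<sigma>': "\<And>x. \<sigma>' x \<in> Y0" "\<And>x. \<tau>' (\<sigma>' x) = x" "\<And>z. z \<in> Y0 \<Longrightarrow> \<sigma>' (\<tau>' z) = z"
      "AE x in M. \<sigma>' x = x"
    by (rule borel_iso_conull[OF M False Y0b Y0n]) blast
  show ?thesis
  proof (rule that[of "\<lambda>x. \<tau>' (T' (\<sigma> x))" "\<lambda>x. \<tau> (T (\<sigma>' x))" w])
    show "(\<lambda>x. \<tau>' (T' (\<sigma> x))) \<in> measurable M M" unfolding mM by measurable
    show "\<tau> (T (\<sigma>' (\<tau>' (T' (\<sigma> x))))) = x" for x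
      using \<sigma>(1)[of x] \<sigma>(2)[of x] \<sigma>'(3)[of "T' (\<sigma> x)"] by (simp add: X0_def Y0_def)
    show "\<tau>' (T' (\<sigma> (\<tau> (T (\<sigma>' x))))) = x" for x
      using \<sigma>'(1)[of x] \<sigma>'(2)[of x] \<sigma>(3)[of "T (\<sigma>' x)"] by (simp add: X0_def Y0_def)
    \<comment> \<open>The corrections are the identity almost everywhere, and \<open>T\<close> pulls
      null sets back to null sets, so the corrected map still represents \<open>W\<close> with
      weight \<open>w\<close>.\<close>
    have "AE x in M. \<tau> (T x) = T x" by (rule AE_compose_weight[OF R c(1) \<sigma>(4)])
    with \<sigma>'(4) have S1: "AE x in M. \<tau> (T (\<sigma>' x)) = T x" by eventually_elim simp
    have "AE x in M. W h x = h (\<tau> (T (\<sigma>' x))) * w x" if "integrable M h" for h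
      using represented_byD(4)[OF R that] S1 by eventually_elim simp
    moreover have "(\<lambda>x. \<tau> (T (\<sigma>' x))) \<in> measurable M M" unfolding mM by measurable
    ultimately show "represented_by (\<lambda>x. \<tau> (T (\<sigma>' x))) w"
      using represented_byD(2,3)[OF R] by (simp add: represented_by_def)
    show "AE x in M. 0 < w x" by (rule c(1))
  qed
qed

end

section \<open>Nonsingular transformations\<close>

lemma standardD:
  assumes "standard_sf_nonatomic M"
  shows "sets M = sets borel" "sigma_finite_measure M" "space M = UNIV"
  using assms sets_eq_imp_space_eq[of M borel] by (auto simp: standard_sf_nonatomic_def)

lemma nonsingular_inv_facts:
  fixes M :: "('a::polish_space) measure"
  assumes M: "standard_sf_nonatomic M" and S: "nonsingular_inv M S"
  defines "T \<equiv> the_inv_into (space M) S"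
  shows "S \<in> measurable M M" "T \<in> measurable M M" "T (S x) = x" "S (T x) = x"
    and "density M (\<lambda>x. ennreal (Sder M S x)) = distr M M S"
    and "AE x in M. 0 < Sder M S x"
    and "AE x in M. P x \<Longrightarrow> AE x in M. P (S x)"
    and "AE x in M. P x \<Longrightarrow> AE x in M. P (T x)"
proof -
  interpret sigma_finite_measure M by (rule standardD(2)[OF M])
  note spM = standardD(3)[OF M]
  show m[measurable]: "S \<in> measurable M M" "T \<in> measurable M M" using S by (auto simp: nonsingular_inv_def T_def)
  have "bij S" using S spM by (simp add: nonsingular_inv_def)
  then show TS: "T (S x) = x" and ST: "S (T x) = x" for x
    using the_inv_into_f_f[of S UNIV x] f_the_inv_into_f[of S UNIV x]
    unfolding T_def spM by (simp_all add: bij_def)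
  have null: "emeasure M (S -` A) = 0 \<longleftrightarrow> emeasure M A = 0" if "A \<in> sets M" for A
    using S that spM by (simp add: nonsingular_inv_def)
  have ac: "absolutely_continuous M (distr M M S)"
    unfolding absolutely_continuous_def
  proof
    fix A assume A: "A \<in> null_sets M"
    then have "emeasure (distr M M S) A = 0"
      using null[of A] spM by (subst emeasure_distr) auto
    then show "A \<in> null_sets (distr M M S)" using A by (simp add: null_sets_def)
  qed
  \<comment> \<open>Pushing forward again by the inverse returns \<open>M\<close>, so the
    pushforward by \<open>S\<close> is sigma-finite. Its derivative is therefore finite almost
    everywhere and \<open>enn2real\<close> loses nothing.\<close>
  have "distr (distr M M S) M T = distr M M (\<lambda>x. x)"
    by (subst distr_distr) (simp_all add: comp_def TS)
  then have "sigma_finite_measure (distr (distr M M S) M T)"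
    using sigma_finite_measure_axioms by simp
  then have sf: "sigma_finite_measure (distr M M S)"
    by (rule sigma_finite_measure_distr) simp
  have "AE x in M. RN_deriv M (distr M M S) x \<noteq> \<infinity>"
    by (rule RN_deriv_finite[OF sf ac]) simp
  then have e: "AE x in M. ennreal (Sder M S x) = RN_deriv M (distr M M S) x"
    by eventually_elim (simp add: Sder_def less_top)
  have [measurable]: "Sder M S \<in> borel_measurable M" unfolding Sder_def[abs_def] by measurable
  have "density M (\<lambda>x. ennreal (Sder M S x)) = density M (RN_deriv M (distr M M S))"
    by (rule density_cong[OF _ _ e]) auto
  also have "\<dots> = distr M M S" by (rule density_RN_deriv[OF ac]) simp
  finally show d: "density M (\<lambda>x. ennreal (Sder M S x)) = distr M M S" .
  have pb: "AE x in M. P (S x)" if P: "AE x in M. P x" for P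
  proof -
    obtain N where N: "{x \<in> space M. \<not> P x} \<subseteq> N" "N \<in> sets M" "emeasure M N = 0" using AE_E[OF P] by auto
    have SN: "S -` N \<in> sets M" using measurable_sets[OF m(1) N(2)] spM by simp
    then have "S -` N \<in> null_sets M" using null[OF N(2)] N(3) by (simp add: null_sets_def)
    from AE_not_in[OF this] show ?thesis by eventually_elim (use N(1) spM in auto)
  qed
  then show "AE x in M. P x \<Longrightarrow> AE x in M. P (S x)" .
  have pT: "AE x in M. P (T x)" if P: "AE x in M. P x" for P
  proof -
    obtain N where N: "{x \<in> space M. \<not> P x} \<subseteq> N" "N \<in> sets M" "emeasure M N = 0" using AE_E[OF P] by auto
    have TN: "T -` N \<in> sets M" using measurable_sets[OF m(2) N(2)] spM by simp
    have "S -` (T -` N) = N" by (auto simp: TS)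
    then have "T -` N \<in> null_sets M" using null[OF TN] N(3) TN by (simp add: null_sets_def)
    from AE_not_in[OF this] show ?thesis by eventually_elim (use N(1) spM in auto)
  qed
  then show "AE x in M. P x \<Longrightarrow> AE x in M. P (T x)" .
  \<comment> \<open>The preimage of the zero set of the derivative has measure equal to the integral
    of the derivative over that set, which is 0; nonsingularity then makes the set itself
    null.\<close>
  define Z where "Z = {x. Sder M S x = 0}"
  have Z[measurable]: "Z \<in> sets M"
    using spM measurable_sets[of "Sder M S" M borel "{0}"] by (simp add: Z_def vimage_def)
  have "emeasure M (S -` Z) = emeasure (distr M M S) Z" using spM by (simp add: emeasure_distr)
  also have "\<dots> = (\<integral>\<^sup>+x. ennreal (Sder M S x) * indicator Z x \<partial>M)"
    unfolding d[symmetric] by (simp add: emeasure_density)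
  also have "\<dots> = (\<integral>\<^sup>+x. 0 \<partial>M)" by (intro nn_integral_cong) (auto simp: Z_def indicator_def)
  finally have "emeasure M (S -` Z) = 0" by simp
  then have "Z \<in> null_sets M" using null[OF Z] Z by (simp add: null_sets_def)
  from AE_not_in[OF this] show "AE x in M. 0 < Sder M S x"
    by eventually_elim (simp add: Z_def Sder_def less_le)
qed

text \<open>Change of variables: the derivative is the density of the pushforward by
  \<open>S\<close>, and composing with \<open>S\<close> cancels the inverse.\<close>

lemma nn_integral_weighted_composition:
  fixes M :: "('a::polish_space) measure" and H :: "'a \<Rightarrow> ennreal"
  assumes M: "standard_sf_nonatomic M" and S: "nonsingular_inv M S"
    and H[measurable]: "H \<in> borel_measurable M"
  shows "(\<integral>\<^sup>+x. H (the_inv_into (space M) S x) * Sder M S x \<partial>M) = (\<integral>\<^sup>+x. H x \<partial>M)"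
proof -
  note fa = nonsingular_inv_facts[OF M S]
  note [measurable] = fa(1,2)
  have [measurable]: "Sder M S \<in> borel_measurable M" unfolding Sder_def[abs_def] by measurable
  have "(\<integral>\<^sup>+x. H (the_inv_into (space M) S x) * Sder M S x \<partial>M) =
      (\<integral>\<^sup>+x. H (the_inv_into (space M) S x) \<partial>density M (\<lambda>x. ennreal (Sder M S x)))"
    by (subst nn_integral_density) (auto simp: mult.commute)
  also have "\<dots> = (\<integral>\<^sup>+x. H x \<partial>M)"
    unfolding fa(5) by (subst nn_integral_distr) (simp_all add: fa(3))
  finally show ?thesis .
qed

lemma US_isometry:
  fixes M :: "('a::polish_space) measure"
  assumes M: "standard_sf_nonatomic M" and S: "nonsingular_inv M S"
    and [measurable]: "h \<in> borel_measurable M"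
  shows "integrable M (US M S h) \<longleftrightarrow> integrable M h" "L1norm M (US M S h) = L1norm M h"
proof -
  note [measurable] = nonsingular_inv_facts(1,2)[OF M S]
  have [measurable]: "Sder M S \<in> borel_measurable M" unfolding Sder_def[abs_def] by measurable
  have m[measurable]: "US M S h \<in> borel_measurable M" unfolding US_def by measurable
  have "(\<integral>\<^sup>+x. cmod (US M S h x) \<partial>M) =
      (\<integral>\<^sup>+x. ennreal (cmod (h (the_inv_into (space M) S x))) * ennreal (Sder M S x) \<partial>M)"
    by (intro nn_integral_cong) (simp add: US_def norm_mult Sder_def ennreal_mult')
  also have "\<dots> = (\<integral>\<^sup>+x. cmod (h x) \<partial>M)"
    by (rule nn_integral_weighted_composition[OF M S]) measurable
  finally have eq: "(\<integral>\<^sup>+x. cmod (US M S h x) \<partial>M) = (\<integral>\<^sup>+x. cmod (h x) \<partial>M)" .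
  then show "integrable M (US M S h) \<longleftrightarrow> integrable M h"
    by (simp add: integrable_iff_bounded)
  show "L1norm M (US M S h) = L1norm M h"
    unfolding L1norm_def by (simp add: integral_eq_nn_integral eq)
qed

text \<open>\<open>h\<close> solves the defining equation of \<open>US\<close>; the division is
  legitimate almost everywhere because the derivative is positive. Integrability comes back from
  \<open>g\<close> through the isometry.\<close>

lemma US_inverse:
  fixes M :: "('a::polish_space) measure"
  assumes M: "standard_sf_nonatomic M" and S: "nonsingular_inv M S" and g: "integrable M g"
  defines "h \<equiv> \<lambda>x. g (S x) / complex_of_real (Sder M S (S x))"
  shows "integrable M h" "AE x in M. US M S h x = g x"
proof -
  note fa = nonsingular_inv_facts[OF M S]
  note [measurable] = fa(1,2)
  have [measurable]: "Sder M S \<in> borel_measurable M" unfolding Sder_def[abs_def] by measurable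
  have [measurable]: "g \<in> borel_measurable M" using g by simp
  have m[measurable]: "h \<in> borel_measurable M" "US M S h \<in> borel_measurable M" unfolding US_def h_def by measurable
  show e: "AE x in M. US M S h x = g x"
    using fa(6) by eventually_elim (simp add: US_def h_def fa(4))
  then have "integrable M (US M S h)" using g by (subst integrable_cong_AE[of _ _ g]) auto
  then show "integrable M h" using US_isometry(1)[OF M S] by simp
qed

lemma US_in_UR:
  fixes M :: "('a::polish_space) measure"
  assumes M: "standard_sf_nonatomic M" and S: "nonsingular_inv M S"
  shows "US M S \<in> UR M"
proof -
  note fa = nonsingular_inv_facts[OF M S]
  have real: "AE x in M. Im (US M S h x) = 0" if "AE x in M. Im (h x) = 0" for h
    using fa(8)[OF that] by eventually_elim (simp add: US_def)
  have 1: "US M S h \<in> L1 M \<and> L1norm M (US M S h) = L1norm M h" if "h \<in> L1 M" for h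
    using that US_isometry[OF M S, of h] by (auto simp: L1_def)
  have 2: "aeeq M (US M S h) (US M S g)" if "aeeq M h g" for h g
    using fa(8)[OF that[unfolded aeeq_def]] unfolding aeeq_def by eventually_elim (simp add: US_def)
  have 3: "US M S (\<lambda>x. h x + g x) = (\<lambda>x. US M S h x + US M S g x)" for h g
    by (simp add: US_def distrib_right fun_eq_iff)
  have 4: "US M S (\<lambda>x. c * h x) = (\<lambda>x. c * US M S h x)" for c h
    by (simp add: US_def ac_simps fun_eq_iff)
  have 5: "\<exists>h\<in>L1 M. aeeq M (US M S h) g" if "g \<in> L1 M" for g
    using US_inverse[OF M S, of g] that unfolding L1_def aeeq_def by blast
  have 6: "US M S h \<in> L1R M" if "h \<in> L1R M" for h
    using that real[of h] 1[of h] by (simp add: L1R_def L1_def)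
  have 7: "\<exists>h\<in>L1R M. aeeq M (US M S h) g" if "g \<in> L1R M" for g
  proof -
    have g: "integrable M g" "AE x in M. Im (g x) = 0" using that by (auto simp: L1R_def)
    have "AE x in M. Im (g (S x) / complex_of_real (Sder M S (S x))) = 0"
      using fa(7)[OF g(2)] by eventually_elim simp
    then show ?thesis using US_inverse[OF M S g(1)] unfolding L1R_def aeeq_def by blast
  qed
  show ?thesis unfolding UR_def using 1 2 5 6 7 by (simp add: 3 4 aeeq_def)
qed

text \<open>With \<open>T\<close> the inverse of \<open>S\<close>, the image of \<open>h\<close>
  plus 1 equals \<open>(h \<circ> T + 1) * Sder M S\<close>, so the bound \<open>-1\<close> is
  preserved. Solving the same identity for \<open>h\<close> gives surjectivity.\<close>

lemma US_preserves_Cm1: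
  fixes M :: "('a::polish_space) measure"
  assumes M: "standard_sf_nonatomic M" and S: "S \<in> Aut1 M"
  shows "aff_preserves M (\<lambda>x. complex_of_real (Sder M S x - 1)) (US M S) (Cm1 M)"
proof -
  have ns: "nonsingular_inv M S" and d: "integrable M (\<lambda>x. Sder M S x - 1)" using S by (auto simp: Aut1_def)
  note fa = nonsingular_inv_facts[OF M ns]
  have dc: "integrable M (\<lambda>x. complex_of_real (Sder M S x - 1))"
    by (rule integrable_of_real[OF d])
  have 1: "(\<lambda>x. complex_of_real (Sder M S x - 1) + US M S h x) \<in> Cm1 M" if "h \<in> Cm1 M" for h
  proof -
    have h: "integrable M h" "AE x in M. Im (h x) = 0 \<and> - 1 \<le> Re (h x)" using that by (auto simp: Cm1_def)
    have "integrable M (US M S h)" using US_isometry(1)[OF M ns, of h] h by simp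
    then have i: "integrable M (\<lambda>x. complex_of_real (Sder M S x - 1) + US M S h x)"
      using dc by (rule Bochner_Integration.integrable_add[rotated])
    have "AE x in M. Im (complex_of_real (Sder M S x - 1) + US M S h x) = 0 \<and>
        - 1 \<le> Re (complex_of_real (Sder M S x - 1) + US M S h x)"
      using fa(8)[OF h(2)]
    proof eventually_elim
      case (elim x)
      have "0 \<le> (Re (h (the_inv_into (space M) S x)) + 1) * Sder M S x"
        using elim by (intro mult_nonneg_nonneg) (auto simp: Sder_def)
      then show ?case using elim by (simp add: US_def algebra_simps)
    qed
    with i show ?thesis by (simp add: Cm1_def)
  qed
  have 2: "\<exists>h\<in>Cm1 M. aeeq M g (\<lambda>x. complex_of_real (Sder M S x - 1) + US M S h x)" if "g \<in> Cm1 M" for g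
  proof -
    have g: "integrable M g" "AE x in M. Im (g x) = 0 \<and> - 1 \<le> Re (g x)" using that by (auto simp: Cm1_def)
    define u where "u x = g x - complex_of_real (Sder M S x - 1)" for x
    have u: "integrable M u" unfolding u_def using g dc by (intro Bochner_Integration.integrable_diff)
    define h where "h x = u (S x) / complex_of_real (Sder M S (S x))" for x
    have h: "integrable M h" "AE x in M. US M S h x = u x"
      using US_inverse[OF M ns u] by (simp_all add: h_def[abs_def])
    have "AE x in M. Im (h x) = 0 \<and> - 1 \<le> Re (h x)"
      using fa(7)[OF g(2)] fa(7)[OF fa(6)]
    proof eventually_elim
      case (elim x)
      have "Re (h x) = (Re (g (S x)) + 1) / Sder M S (S x) - 1"
        using elim by (simp add: h_def u_def field_simps)
      moreover have "0 \<le> (Re (g (S x)) + 1) / Sder M S (S x)" using elim by simp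
      ultimately show ?case using elim by (simp add: h_def u_def)
    qed
    then have "h \<in> Cm1 M" using h by (simp add: Cm1_def)
    moreover have "aeeq M g (\<lambda>x. complex_of_real (Sder M S x - 1) + US M S h x)"
      unfolding aeeq_def using h(2) by eventually_elim (simp add: u_def)
    ultimately show ?thesis by blast
  qed
  show ?thesis unfolding aff_preserves_def using 1 2 by blast
qed

section \<open>Affine maps preserving the cone\<close>

lemma nonneg_of_nat_multiples:
  fixes a b :: real
  assumes "\<And>n::nat. b \<le> real n * a"
  shows "0 \<le> a"
proof (rule ccontr)
  assume "\<not> 0 \<le> a"
  then have "\<forall>y. \<exists>n. y < real n * - a" by (intro reals_Archimedean3) simp
  then obtain n :: nat where "- b < real n * - a" by blast
  with assms[of n] show False by simp
qed

text \<open>The recession cone of \<open>C = f + V C\<close> is the positive cone: dividing \<open>f + V (n h) \<ge> -1\<close> by \<open>n\<close> gives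
  \<open>V h \<ge> 0\<close> for \<open>h \<ge> 0\<close>, and likewise for the inverse of \<open>V\<close>.\<close>

lemma real_part_isometries:
  fixes M :: "('a::polish_space) measure"
  assumes M: "standard_sf_nonatomic M" and f: "f \<in> L1R M" and V: "V \<in> UR M"
    and aff: "aff_preserves M f V (Cm1 M)"
    and W_def: "\<And>h x. W h x = Re (V (\<lambda>x. complex_of_real (h x)) x)"
  obtains W' where "positive_L1_isometry M W" "positive_L1_isometry M W'"
    "\<forall>h. integrable M h \<longrightarrow> (AE x in M. W (W' h) x = h x)"
    "\<forall>h. integrable M h \<longrightarrow> (AE x in M. W' (W h) x = h x)"
    "\<forall>h. integrable M h \<longrightarrow> (AE x in M. V h x =
      complex_of_real (W (\<lambda>x. Re (h x)) x) + \<i> * complex_of_real (W (\<lambda>x. Im (h x)) x))"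
proof -
  interpret sigma_finite_measure M by (rule standardD(2)[OF M])
  have V_int: "integrable M (V h)" and V_norm: "L1norm M (V h) = L1norm M h" if "integrable M h" for h
    using V that by (auto simp: UR_def L1_def)
  have V_cong: "AE x in M. V h x = V g x" if "integrable M h" "integrable M g" "AE x in M. h x = g x" for h g
    using V that by (auto simp: UR_def L1_def aeeq_def)
  have V_add: "AE x in M. V (\<lambda>x. h x + g x) x = V h x + V g x" if "integrable M h" "integrable M g" for h g
    using V that by (auto simp: UR_def L1_def aeeq_def)
  have V_scale: "AE x in M. V (\<lambda>x. c * h x) x = c * V h x" if "integrable M h" for c h
    using V that by (auto simp: UR_def L1_def aeeq_def)
  have V_real: "AE x in M. Im (V h x) = 0" if "integrable M h" "AE x in M. Im (h x) = 0" for h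
    using V that by (auto simp: UR_def L1R_def)
  have V_surj: "\<exists>h. integrable M h \<and> (AE x in M. Im (h x) = 0) \<and> (AE x in M. V h x = g x)"
    if "integrable M g" "AE x in M. Im (g x) = 0" for g
    using V that unfolding UR_def L1R_def aeeq_def by blast
  have f_int: "integrable M f" and f_real: "AE x in M. Im (f x) = 0" using f by (auto simp: L1R_def)
  have VW: "AE x in M. V (\<lambda>x. complex_of_real (h x)) x = complex_of_real (W h x)" if "integrable M h" for h
    using V_real[of "\<lambda>x. complex_of_real (h x)"] that by (auto simp: W_def complex_eq_iff)
  have W_int: "integrable M (W h)" if "integrable M h" for h
    unfolding W_def using V_int[of "\<lambda>x. complex_of_real (h x)"] that by simp
  have W_cong: "AE x in M. W h x = W g x" if "integrable M h" "integrable M g" "AE x in M. h x = g x" for h g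
    using V_cong[of "\<lambda>x. complex_of_real (h x)" "\<lambda>x. complex_of_real (g x)"] that by (auto simp: W_def)
  have W_add: "AE x in M. W (\<lambda>x. h x + g x) x = W h x + W g x" if "integrable M h" "integrable M g" for h g
    using V_add[of "\<lambda>x. complex_of_real (h x)" "\<lambda>x. complex_of_real (g x)"] that by (auto simp: W_def)
  have W_scale: "AE x in M. W (\<lambda>x. c * h x) x = c * W h x" if "integrable M h" for c h
    using V_scale[of "\<lambda>x. complex_of_real (h x)" "complex_of_real c"] that by (auto simp: W_def)
  have W_norm: "(\<integral>x. \<bar>W h x\<bar> \<partial>M) = (\<integral>x. \<bar>h x\<bar> \<partial>M)" if h: "integrable M h" for h
  proof -
    have "(\<integral>x. \<bar>W h x\<bar> \<partial>M) = L1norm M (V (\<lambda>x. complex_of_real (h x)))"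
      unfolding L1norm_def using VW[OF h] W_int[OF h] V_int[of "\<lambda>x. complex_of_real (h x)"] h
      by (intro integral_cong_AE) auto
    also have "\<dots> = (\<integral>x. \<bar>h x\<bar> \<partial>M)" using h by (simp add: V_norm) (simp add: L1norm_def)
    finally show ?thesis .
  qed
  have onto: "\<exists>k\<in>Cm1 M. AE x in M. g x = f x + V k x" if "g \<in> Cm1 M" for g
    using aff that unfolding aff_preserves_def aeeq_def by simp
  have fwd: "AE x in M. - 1 \<le> Re (f x) + W h x" if h: "integrable M h" "AE x in M. - 1 \<le> h x" for h
  proof -
    have "(\<lambda>x. complex_of_real (h x)) \<in> Cm1 M" using h by (simp add: Cm1_def)
    then have "(\<lambda>x. f x + V (\<lambda>x. complex_of_real (h x)) x) \<in> Cm1 M" using aff unfolding aff_preserves_def by blast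
    then show ?thesis unfolding Cm1_def W_def by auto
  qed
  have W_nonneg: "AE x in M. 0 \<le> W h x" if h: "integrable M h" "AE x in M. 0 \<le> h x" for h
  proof -
    have "AE x in M. - 1 \<le> Re (f x) + real n * W h x" for n :: nat
    proof -
      have i: "integrable M (\<lambda>x. real n * h x)" using h by simp
      have "AE x in M. - 1 \<le> real n * h x"
        using h(2) by eventually_elim (simp add: order_trans[OF _ mult_nonneg_nonneg])
      from fwd[OF i this] W_scale[OF h(1), of "real n"] show ?thesis by eventually_elim simp
    qed
    then have "AE x in M. \<forall>n::nat. - 1 \<le> Re (f x) + real n * W h x" by (simp add: AE_all_countable)
    then show ?thesis
    proof eventually_elim
      case (elim x)
      show ?case by (rule nonneg_of_nat_multiples[of "- 1 - Re (f x)"]) (use elim in \<open>simp add: algebra_simps\<close>)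
    qed
  qed
  have W: "positive_L1_isometry M W"
    by (intro positive_L1_isometry.intro positive_L1_isometry_axioms.intro sigma_finite_measure_axioms
        standardD(1)[OF M]; (rule W_int W_cong W_add W_scale W_norm W_nonneg; assumption))
  interpret W: positive_L1_isometry M W by (rule W)
  have inj: "AE x in M. h x = g x"
    if h: "integrable M h" and g: "integrable M g" and e: "AE x in M. W h x = W g x" for h g
  proof -
    have d: "integrable M (\<lambda>x. h x - g x)" using h g by simp
    have "(\<integral>x. \<bar>h x - g x\<bar> \<partial>M) = (\<integral>x. \<bar>W (\<lambda>x. h x - g x) x\<bar> \<partial>M)" using W_norm[OF d] by simp
    also have "\<dots> = (\<integral>x. 0 \<partial>M)"
    proof (rule integral_cong_AE)
      show "AE x in M. \<bar>W (\<lambda>x. h x - g x) x\<bar> = 0"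
        using W.W_diff[OF h g] e by eventually_elim simp
    qed (use W_int[OF d] in auto)
    finally have "(\<integral>x. \<bar>h x - g x\<bar> \<partial>M) = 0" by simp
    then have "AE x in M. \<bar>h x - g x\<bar> = 0"
      using integral_nonneg_eq_0_iff_AE[OF integrable_abs[OF d]] by simp
    then show ?thesis by eventually_elim simp
  qed
  \<comment> \<open>A choice of preimages; \<open>inj\<close> makes it unique up to null sets, and
    the properties of \<open>W\<close> pass to it.\<close>
  define W' where "W' h = (SOME g. integrable M g \<and> (AE x in M. W g x = h x))" for h
  have W': "integrable M (W' h) \<and> (AE x in M. W (W' h) x = h x)" if h: "integrable M h" for h
  proof -
    obtain g where g: "integrable M g" "AE x in M. Im (g x) = 0" "AE x in M. V g x = complex_of_real (h x)"
      using V_surj[of "\<lambda>x. complex_of_real (h x)"] h by auto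
    \<comment> \<open>The preimage is real only almost everywhere, hence is replaced by its real
      part.\<close>
    have "AE x in M. V (\<lambda>x. complex_of_real (Re (g x))) x = V g x"
      using g(1,2) by (intro V_cong) (auto simp: complex_eq_iff)
    with g(3) have "AE x in M. W (\<lambda>x. Re (g x)) x = h x"
      unfolding W_def by eventually_elim simp
    then have "\<exists>g. integrable M g \<and> (AE x in M. W g x = h x)"
      using g(1) by (intro exI[of _ "\<lambda>x. Re (g x)"]) simp
    from someI_ex[OF this] show ?thesis unfolding W'_def .
  qed
  have W'_int: "integrable M (W' h)" and WW': "AE x in M. W (W' h) x = h x" if "integrable M h" for h
    using W'[OF that] by auto
  have W'_cong: "AE x in M. W' h x = W' g x"
    if h: "integrable M h" and g: "integrable M g" and e: "AE x in M. h x = g x" for h g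
  proof (rule inj[OF W'_int[OF h] W'_int[OF g]])
    show "AE x in M. W (W' h) x = W (W' g) x" using WW'[OF h] WW'[OF g] e by eventually_elim simp
  qed
  have W'_add: "AE x in M. W' (\<lambda>x. h x + g x) x = W' h x + W' g x"
    if h: "integrable M h" and g: "integrable M g" for h g
  proof (rule inj)
    have s: "integrable M (\<lambda>x. h x + g x)" using h g by simp
    show "integrable M (W' (\<lambda>x. h x + g x))" by (rule W'_int[OF s])
    show "integrable M (\<lambda>x. W' h x + W' g x)" using W'_int h g by simp
    show "AE x in M. W (W' (\<lambda>x. h x + g x)) x = W (\<lambda>x. W' h x + W' g x) x"
      using WW'[OF s] W_add[OF W'_int[OF h] W'_int[OF g]] WW'[OF h] WW'[OF g] by eventually_elim simp
  qed
  have W'_scale: "AE x in M. W' (\<lambda>x. c * h x) x = c * W' h x" if h: "integrable M h" for c h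
  proof (rule inj)
    have s: "integrable M (\<lambda>x. c * h x)" using h by simp
    show "integrable M (W' (\<lambda>x. c * h x))" by (rule W'_int[OF s])
    show "integrable M (\<lambda>x. c * W' h x)" using W'_int h by simp
    show "AE x in M. W (W' (\<lambda>x. c * h x)) x = W (\<lambda>x. c * W' h x) x"
      using WW'[OF s] W_scale[OF W'_int[OF h], of c] WW'[OF h] by eventually_elim simp
  qed
  have W'_norm: "(\<integral>x. \<bar>W' h x\<bar> \<partial>M) = (\<integral>x. \<bar>h x\<bar> \<partial>M)" if h: "integrable M h" for h
  proof -
    have "(\<integral>x. \<bar>W' h x\<bar> \<partial>M) = (\<integral>x. \<bar>W (W' h) x\<bar> \<partial>M)" using W_norm[OF W'_int[OF h]] by simp
    also have "\<dots> = (\<integral>x. \<bar>h x\<bar> \<partial>M)"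
      using WW'[OF h] h W_int[OF W'_int[OF h]] by (intro integral_cong_AE) auto
    finally show ?thesis .
  qed
  have W'_nonneg: "AE x in M. 0 \<le> W' h x" if h: "integrable M h" "AE x in M. 0 \<le> h x" for h
  proof -
    have Rf: "integrable M (\<lambda>x. Re (f x))" using f_int by simp
    have "AE x in M. W' (\<lambda>x. Re (f x)) x - 1 \<le> real n * W' h x" for n :: nat
    proof -
      have "(\<lambda>x. complex_of_real (real n * h x)) \<in> Cm1 M"
      proof -
        have "AE x in M. - 1 \<le> real n * h x"
          using h(2) by eventually_elim (simp add: order_trans[OF _ mult_nonneg_nonneg])
        then show ?thesis using h(1) by (simp add: Cm1_def)
      qed
      from onto[OF this] obtain k where k: "k \<in> Cm1 M" "AE x in M. complex_of_real (real n * h x) = f x + V k x"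
        by blast
      have k': "integrable M k" "AE x in M. Im (k x) = 0" "AE x in M. - 1 \<le> Re (k x)"
        using k(1) by (auto simp: Cm1_def)
      have kr: "integrable M (\<lambda>x. Re (k x))" using k' by simp
      have Vk: "AE x in M. V (\<lambda>x. complex_of_real (Re (k x))) x = V k x"
        using k' by (intro V_cong) (auto simp: complex_eq_iff)
      \<comment> \<open>This is \<open>W'\<close> applied to \<open>n h = f + V k\<close>; since
        \<open>k \<ge> -1\<close>, dividing by \<open>n\<close> yields positivity of
        \<open>W' h\<close>.\<close>
      have "AE x in M. real n * W' h x - W' (\<lambda>x. Re (f x)) x = Re (k x)"
      proof (rule inj[OF _ kr])
        have nh: "integrable M (\<lambda>x. real n * W' h x)" using W'_int[OF h(1)] by simp
        show "integrable M (\<lambda>x. real n * W' h x - W' (\<lambda>x. Re (f x)) x)" using nh W'_int[OF Rf] by simp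
        show "AE x in M. W (\<lambda>x. real n * W' h x - W' (\<lambda>x. Re (f x)) x) x = W (\<lambda>x. Re (k x)) x"
          using W.W_diff[OF nh W'_int[OF Rf]] W_scale[OF W'_int[OF h(1)], of "real n"]
            WW'[OF h(1)] WW'[OF Rf] k(2) Vk
        proof eventually_elim
          case (elim x)
          have "W (\<lambda>x. Re (k x)) x = real n * h x - Re (f x)"
            using arg_cong[OF elim(5), of Re] elim(6) by (simp add: W_def)
          then show ?case using elim by simp
        qed
      qed
      with k'(3) show ?thesis by eventually_elim simp
    qed
    then have "AE x in M. \<forall>n::nat. W' (\<lambda>x. Re (f x)) x - 1 \<le> real n * W' h x" by (simp add: AE_all_countable)
    then show ?thesis by eventually_elim (rule nonneg_of_nat_multiples, blast)
  qed
  have iso': "positive_L1_isometry M W'"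
    by (intro positive_L1_isometry.intro positive_L1_isometry_axioms.intro sigma_finite_measure_axioms
        standardD(1)[OF M]; (rule W'_int W'_cong W'_add W'_scale W'_norm W'_nonneg; assumption))
  have W'W: "AE x in M. W' (W h) x = h x" if h: "integrable M h" for h
    by (rule inj[OF W'_int[OF W_int[OF h]] h WW'[OF W_int[OF h]]])
  have VW_eq: "AE x in M. V h x =
      complex_of_real (W (\<lambda>x. Re (h x)) x) + \<i> * complex_of_real (W (\<lambda>x. Im (h x)) x)"
    if h: "integrable M h" for h
  proof -
    have r: "integrable M (\<lambda>x. Re (h x))" and i: "integrable M (\<lambda>x. Im (h x))" using h by auto
    have rc: "integrable M (\<lambda>x. complex_of_real (Re (h x)))"
      and ic: "integrable M (\<lambda>x. complex_of_real (Im (h x)))"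
      using r i by auto
    have "h = (\<lambda>x. complex_of_real (Re (h x)) + \<i> * complex_of_real (Im (h x)))"
      by (simp add: fun_eq_iff complex_eq)
    with V_add[OF rc integrable_mult_right[OF ic]]
    have "AE x in M. V h x = V (\<lambda>x. complex_of_real (Re (h x))) x + V (\<lambda>x. \<i> * complex_of_real (Im (h x))) x"
      by metis
    with V_scale[OF ic, of \<i>] VW[OF r] VW[OF i] show ?thesis by eventually_elim simp
  qed
  show ?thesis by (rule that[OF W iso']) (simp_all add: WW' W'W VW_eq)
qed

text \<open>\<open>T\<close> carries \<open>density M w\<close> to \<open>M\<close>, so its inverse
  \<open>S\<close> carries \<open>M\<close> to \<open>density M w\<close>; uniqueness of the
  Radon-Nikodym derivative identifies \<open>w\<close>. Positivity of \<open>w\<close> makes the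
  null sets agree.\<close>

lemma Sder_eq_weight:
  fixes M :: "('a::polish_space) measure"
  assumes "positive_L1_isometry M W" and M: "standard_sf_nonatomic M"
    and S: "S \<in> measurable M M" "\<And>x. T (S x) = x" "\<And>x. S (T x) = x"
    and R: "positive_L1_isometry.represented_by M W T w" and w_pos: "AE x in M. 0 < w x"
  shows "nonsingular_inv M S" "the_inv_into (space M) S = T" "AE x in M. Sder M S x = w x"
proof -
  interpret positive_L1_isometry M W by fact
  note spM = standardD(3)[OF M]
  note [measurable] = S(1) represented_byD(1,2)[OF R]
  have "density M w = distr (density M w) M (\<lambda>x. S (T x))" by (simp add: S(3) distr_id2)
  also have "\<dots> = distr (distr (density M w) M T) M S" by (subst distr_distr) (simp_all add: comp_def)
  also have "\<dots> = distr M M S" by (simp add: distr_density_weight[OF R])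
  finally have d: "density M w = distr M M S" .
  have "AE x in M. ennreal (w x) = RN_deriv M (distr M M S) x"
    by (rule RN_deriv_unique[OF _ d]) measurable
  then show "AE x in M. Sder M S x = w x"
  proof eventually_elim
    case (elim x)
    show ?case unfolding Sder_def elim[symmetric] by (simp add: represented_byD(3)[OF R])
  qed
  have bij: "bij S" using S(2,3) by (metis bijI')
  show T: "the_inv_into (space M) S = T"
    unfolding spM using bij S(3) by (metis bij_is_inj the_inv_f_f ext)
  have "emeasure M (S -` A \<inter> space M) = 0 \<longleftrightarrow> emeasure M A = 0" if [measurable]: "A \<in> sets M" for A
  proof -
    have "emeasure M (S -` A \<inter> space M) = emeasure (density M w) A"
      unfolding d by (simp add: emeasure_distr)
    then have "emeasure M (S -` A \<inter> space M) = 0 \<longleftrightarrow> A \<in> null_sets (density M w)"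
      by (simp add: null_sets_def)
    also have "\<dots> \<longleftrightarrow> (AE x in M. x \<in> A \<longrightarrow> ennreal (w x) = 0)"
      by (subst null_sets_density_iff) auto
    also have "\<dots> \<longleftrightarrow> (AE x in M. x \<notin> A)"
    proof
      assume "AE x in M. x \<in> A \<longrightarrow> ennreal (w x) = 0"
      with w_pos show "AE x in M. x \<notin> A" by eventually_elim auto
    qed auto
    also have "\<dots> \<longleftrightarrow> emeasure M A = 0" using AE_iff_null_sets[OF that] that by (simp add: null_sets_def)
    finally show ?thesis .
  qed
  then show "nonsingular_inv M S"
    unfolding nonsingular_inv_def T using bij spM by simp
qed

theorem theorem4p2:
  fixes M :: "('a::polish_space) measure"
  assumes "standard_sf_nonatomic M"
  shows "(\<forall>S\<in>Aut1 M.
            (\<lambda>x. complex_of_real (Sder M S x - 1)) \<in> L1R M \<and> US M S \<in> UR M \<and>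
            aff_preserves M (\<lambda>x. complex_of_real (Sder M S x - 1)) (US M S) (Cm1 M))
       \<and> (\<forall>f V. f \<in> L1R M \<and> V \<in> UR M \<and> aff_preserves M f V (Cm1 M) \<longrightarrow>
            (\<exists>S\<in>Aut1 M. aeeq M f (\<lambda>x. complex_of_real (Sder M S x - 1)) \<and>
                         (\<forall>h\<in>L1 M. aeeq M (V h) (US M S h))))"
proof (intro conjI ballI allI impI; (elim conjE)?)
  fix S assume S: "S \<in> Aut1 M"
  then have ns: "nonsingular_inv M S" and d: "integrable M (\<lambda>x. Sder M S x - 1)" by (auto simp: Aut1_def)
  show "(\<lambda>x. complex_of_real (Sder M S x - 1)) \<in> L1R M"
    unfolding L1R_def using integrable_of_real[OF d] by (simp del: of_real_diff)
  show "US M S \<in> UR M" by (rule US_in_UR[OF assms ns])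
  show "aff_preserves M (\<lambda>x. complex_of_real (Sder M S x - 1)) (US M S) (Cm1 M)"
    by (rule US_preserves_Cm1[OF assms S])
next
  fix f V assume f: "f \<in> L1R M" and V: "V \<in> UR M" and aff: "aff_preserves M f V (Cm1 M)"
  interpret sigma_finite_measure M by (rule standardD(2)[OF assms])
  note spM = standardD(3)[OF assms]
  define W where "W h x = Re (V (\<lambda>x. complex_of_real (h x)) x)" for h x
  obtain W' where W: "positive_L1_isometry M W" and W': "positive_L1_isometry M W'"
    "\<forall>h. integrable M h \<longrightarrow> (AE x in M. W (W' h) x = h x)"
    "\<forall>h. integrable M h \<longrightarrow> (AE x in M. W' (W h) x = h x)"
    and VW: "\<forall>h. integrable M h \<longrightarrow> (AE x in M. V h x =
      complex_of_real (W (\<lambda>x. Re (h x)) x) + \<i> * complex_of_real (W (\<lambda>x. Im (h x)) x))"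
    by (rule real_part_isometries[OF assms f V aff W_def]) (rule that)
  interpret W: positive_L1_isometry M W by (rule W)
  obtain S T w where S: "S \<in> measurable M M" "\<And>x. T (S x) = x" "\<And>x. S (T x) = x"
    and R: "W.represented_by T w" and w_pos: "AE x in M. 0 < w x"
    by (rule W.point_realization[OF assms W']) (rule that)
  note Sf = Sder_eq_weight[OF W assms S R w_pos]
  have V_eq: "AE x in M. V h x = h (T x) * complex_of_real (w x)" if h: "integrable M h" for h
    using VW[rule_format, OF h] W.represented_byD(4)[OF R, of "\<lambda>x. Re (h x)"]
      W.represented_byD(4)[OF R, of "\<lambda>x. Im (h x)"] h
    by (auto simp: complex_eq_iff)
  have V_US: "\<forall>h\<in>L1 M. aeeq M (V h) (US M S h)"
  proof
    fix h assume "h \<in> L1 M"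
    then have "AE x in M. V h x = h (T x) * complex_of_real (w x)" using V_eq by (simp add: L1_def)
    with Sf(3) show "aeeq M (V h) (US M S h)"
      unfolding aeeq_def US_def Sf(2) by eventually_elim simp
  qed
  obtain B :: "nat \<Rightarrow> 'a set" where B: "range B \<subseteq> sets M" "(\<Union>i. B i) = space M" "\<And>i. emeasure M (B i) \<noteq> \<infinity>"
    using sigma_finite by blast
  have ind: "(\<lambda>x. - indicator (B n) x) \<in> Cm1 M" "integrable M (\<lambda>x. - indicator (B n) x :: complex)" for n
  proof -
    have "B n \<in> sets M" using B(1) by auto
    then have "integrable M (\<lambda>x. complex_of_real (indicator (B n) x))"
      using B(3)[of n] by (intro integrable_of_real integrable_real_indicator) (auto simp: less_top)
    moreover have "complex_of_real (indicator (B n) x) = indicator (B n) x" for x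
      by (simp add: indicator_def)
    ultimately show "integrable M (\<lambda>x. - indicator (B n) x :: complex)" by simp
    then show "(\<lambda>x. - indicator (B n) x) \<in> Cm1 M"
      by (simp add: Cm1_def indicator_def)
  qed
  \<comment> \<open>The image of \<open>- indicator (B n)\<close> is
    \<open>f - (indicator (B n) \<circ> T) * w\<close> and is bounded below by \<open>-1\<close>;
    for each \<open>x\<close> some \<open>B n\<close> contains \<open>T x\<close>.\<close>
  have lower: "AE x in M. w x - 1 \<le> Re (f x)"
  proof -
    have "AE x in M. indicator (B n) (T x) * w x - 1 \<le> Re (f x)" for n
    proof -
      have "(\<lambda>x. f x + V (\<lambda>x. - indicator (B n) x) x) \<in> Cm1 M"
        using aff ind(1)[of n] unfolding aff_preserves_def by blast
      then have "AE x in M. - 1 \<le> Re (f x + V (\<lambda>x. - indicator (B n) x) x)" by (auto simp: Cm1_def)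
      with V_eq[OF ind(2)[of n]] show ?thesis
        by eventually_elim (auto simp: indicator_def)
    qed
    then have "AE x in M. \<forall>n. indicator (B n) (T x) * w x - 1 \<le> Re (f x)" by (simp add: AE_all_countable)
    then show ?thesis
    proof eventually_elim
      case (elim x)
      obtain n where "T x \<in> B n" using B(2) spM by auto
      then show ?case using elim[rule_format, of n] by simp
    qed
  qed
  have onto: "\<exists>k\<in>Cm1 M. AE x in M. g x = f x + V k x" if "g \<in> Cm1 M" for g
    using aff that unfolding aff_preserves_def aeeq_def by simp
  \<comment> \<open>Here \<open>- indicator (B n)\<close> is itself an image
    \<open>f + (k \<circ> T) * w\<close> with \<open>k \<ge> -1\<close>, so
    \<open>f \<le> w - indicator (B n)\<close>; for each \<open>x\<close> some \<open>B n\<close>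
    contains \<open>x\<close>.\<close>
  have upper: "AE x in M. Re (f x) \<le> w x - 1"
  proof -
    have "AE x in M. Re (f x) \<le> w x - indicator (B n) x" for n
    proof -
      obtain k where k: "k \<in> Cm1 M" "AE x in M. - indicator (B n) x = f x + V k x"
        using onto[OF ind(1)[of n]] by blast
      have k_int: "integrable M k" and "AE x in M. - 1 \<le> Re (k x)" using k(1) by (auto simp: Cm1_def)
      then have kT: "AE x in M. - 1 \<le> Re (k (T x))" using W.AE_compose_weight[OF R w_pos] by blast
      show ?thesis using k(2) V_eq[OF k_int] kT
      proof eventually_elim
        case (elim x)
        have "0 \<le> (Re (k (T x)) + 1) * w x"
          using elim(3) W.represented_byD(3)[OF R, of x] by (intro mult_nonneg_nonneg) auto
        moreover have "- indicator (B n) x = Re (f x) + Re (k (T x)) * w x"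
          using arg_cong[OF elim(1), of Re] elim(2) by (cases "x \<in> B n") simp_all
        ultimately show ?case by (simp add: algebra_simps)
      qed
    qed
    then have "AE x in M. \<forall>n. Re (f x) \<le> w x - indicator (B n) x" by (simp add: AE_all_countable)
    then show ?thesis
    proof eventually_elim
      case (elim x)
      obtain n where "x \<in> B n" using B(2) spM by auto
      then show ?case using elim[rule_format, of n] by simp
    qed
  qed
  have f_int: "integrable M f" and f_real: "AE x in M. Im (f x) = 0" using f by (auto simp: L1R_def)
  have f_eq: "AE x in M. f x = complex_of_real (Sder M S x - 1)"
    using lower upper Sf(3) f_real by eventually_elim (simp add: complex_eq_iff)
  \<comment> \<open>Membership in \<open>Aut1\<close> is inherited from the integrability of the
    translation \<open>f\<close>.\<close>
  have "integrable M (\<lambda>x. Sder M S x - 1)"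
  proof (rule integrable_cong_AE_imp)
    show "integrable M (\<lambda>x. Re (f x))" using f_int by simp
    show "(\<lambda>x. Sder M S x - 1) \<in> borel_measurable M" unfolding Sder_def by measurable
    show "AE x in M. Re (f x) = Sder M S x - 1" using f_eq by eventually_elim simp
  qed
  then have "S \<in> Aut1 M" using Sf(1) by (simp add: Aut1_def)
  then show "\<exists>S\<in>Aut1 M. aeeq M f (\<lambda>x. complex_of_real (Sder M S x - 1)) \<and>
      (\<forall>h\<in>L1 M. aeeq M (V h) (US M S h))"
    using f_eq V_US unfolding aeeq_def by blast
qed

end
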